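(* Let $\mathcal{A}\subset\mathbb{R}^d$ be a finite set whose convex hull $\Delta$ has dimension $d$, and let $\beta=\{\beta_{\mathbf a}\mid\mathbf a\in\mathcal{A}\}$ be a patch on $\Delta$. If $\beta$ has rational linear precision, then 1. $Y_\beta$ is a rational variety; 2. almost all codimension $d$ planes $L\subset\mathbb{C}\mathbb{P}^{\mathcal{A}}$ containing the center $E_{\mathcal{A}}$ of the tautological projection meet $Y_\beta$ in at most one point outside of $E_{\mathcal{A}}$.
   Context: A (parametric) patch indexed by a finite set $\mathcal{A}\subset\mathbb{R}^d$ with full-dimensional convex hull $\Delta$ is a collection $\{\beta_{\mathbf a}\mid\mathbf a\in\mathcal{A}\}$ of non-negative real-valued functions (blending functions) on $\Delta$ that do not vanish simultaneously at any point of $\Delta$. Blending functions are taken to be smooth, but reparametrized ones are only required to be continuous. They may be normalized by dividing by $\sum_{\mathbf b}\beta_{\mathbf b}$, so that they sum to $1$. The (normalized) patch has linear precision if for every affine function $\Lambda$ on $\mathbb{R}^d$, $\Lambda(x)=\sum_{\mathbf a}\beta_{\mathbf a}(x)\Lambda(\mathbf a)$ for all $x\in\Delta$. Its tautological map is $\tau\colon\Delta\to\Delta$, $\tau(x)=\sum_{\mathbf a}\beta_{\mathbf a}(x)\mathbf a$ (normalized $\beta_{\mathbf a}$); the patch is proper if $\tau$ is a homeomorphism. The reparametrization by a homeomorphism $\psi\colon\Delta\to\Delta$ is the patch $\{\beta_{\mathbf a}\circ\psi\}$. A proper patch has a unique reparametrization with linear precision (namely by $\psi=\tau^{-1}$).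 A patch is rational if it has a reparametrization whose normalized blending functions are rational functions (quotients of polynomials). A patch has rational linear precision if it is proper and its reparametrization having linear precision has normalized blending functions that are rational functions; such a patch is rational. Let $\mathbb{C}\mathbb{P}^{\mathcal{A}}$ be the complex projective space with homogeneous coordinates indexed by $\mathcal{A}$. For a rational patch, reparametrize so that the blending functions are rational and clear denominators so that they are polynomials $\beta_{\mathbf a}$; let $B\subset\mathbb{C}^d$ be their common zero set. Then $Y_\beta\subset\mathbb{C}\mathbb{P}^{\mathcal{A}}$ is the Zariski closure of the image of $\mathbb{C}^d\setminus B\to\mathbb{C}\mathbb{P}^{\mathcal{A}}$, $x\mapsto[\beta_{\mathbf a}(x)\mid\mathbf a\in\mathcal{A}]$. The tautological projection is the linear projection $\pi_{\mathcal{A}}\colon\mathbb{C}\mathbb{P}^{\mathcal{A}}\dashrightarrow\mathbb{C}\mathbb{P}^d$, $[y_{\mathbf a}]\mapsto\sum_{\mathbf a}y_{\mathbf a}\cdot(1,\mathbf a)$. Its center $E_{\mathcal{A}}\subset\mathbb{C}\mathbb{P}^{\mathcal{A}}$ is the linear subspace, of codimension $d+1$, where $\sum_{\mathbf a}y_{\mathbf a}\cdot(1,\mathbf a)=0$. The codimension $d$ planes containing $E_{\mathcal{A}}$ are parametrized by $\mathbb{C}\mathbb{P}^d$ (they are the closures of the fibres of $\pi_{\mathcal{A}}$), and "almost all" means all those in some non-empty Zariski-open subset of this parameter space. A rational variety of dimension $d$ is one that is birational to $\mathbb{C}^d$. *)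

theory Defs
  imports
    "HOL-Analysis.Analysis"
    "HOL-Library.Poly_Mapping"
    "HOL-Library.Function_Algebras"
begin

section \<open>Polynomials in variables indexed by a type\<close>

type_synonym ('i, 'a) mpoly = "('i \<Rightarrow>\<^sub>0 nat) \<Rightarrow>\<^sub>0 'a"

definition mpoly_eval :: "('i, 'a::comm_semiring_1) mpoly \<Rightarrow> ('i \<Rightarrow> 'a) \<Rightarrow> 'a" where
  "mpoly_eval p v =
     (\<Sum>m\<in>Poly_Mapping.keys p. Poly_Mapping.lookup p m *
        (\<Prod>i\<in>Poly_Mapping.keys m. v i ^ Poly_Mapping.lookup m i))"

definition mpoly_homogeneous :: "nat \<Rightarrow> ('i, 'a::zero) mpoly \<Rightarrow> bool" where
  "mpoly_homogeneous n p \<longleftrightarrow>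
     (\<forall>m\<in>Poly_Mapping.keys p. (\<Sum>i\<in>Poly_Mapping.keys m. Poly_Mapping.lookup m i) = n)"

definition complexify :: "('i, real) mpoly \<Rightarrow> ('i, complex) mpoly" where
  "complexify p = Poly_Mapping.map complex_of_real p"


section \<open>Projective space with homogeneous coordinates indexed by a set\<close>

text \<open>
  A point of the projective space over a finite index set \<open>I\<close> is a class of nonzero vectors
  modulo nonzero scalars. Vectors are functions vanishing outside \<open>I\<close>; \<open>proj_point I y\<close>
  is the class of the restriction of \<open>y\<close> to \<open>I\<close>.
\<close>

definition coord_space :: "'i set \<Rightarrow> ('i \<Rightarrow> complex) set" where
  "coord_space I = {y. \<forall>i. i \<notin> I \<longrightarrow> y i = 0}"

definition proj_point :: "'i set \<Rightarrow> ('i \<Rightarrow> complex) \<Rightarrow> ('i \<Rightarrow> complex) set" where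
  "proj_point I y = {\<lambda>i. if i \<in> I then c * y i else 0 | c. c \<noteq> 0}"

definition proj_space :: "'i set \<Rightarrow> ('i \<Rightarrow> complex) set set" where
  "proj_space I = {proj_point I y | y. \<exists>i\<in>I. y i \<noteq> 0}"

definition zariski_closed :: "'i set \<Rightarrow> ('i \<Rightarrow> complex) set set \<Rightarrow> bool" where
  "zariski_closed I Z \<longleftrightarrow>
     (\<exists>S. (\<forall>F\<in>S. \<exists>n. mpoly_homogeneous n F) \<and>
          Z = {p \<in> proj_space I. \<forall>F\<in>S. \<forall>y\<in>p. mpoly_eval F y = 0})"

definition zariski_open :: "'i set \<Rightarrow> ('i \<Rightarrow> complex) set set \<Rightarrow> bool" where
  "zariski_open I W \<longleftrightarrow> W \<subseteq> proj_space I \<and> zariski_closed I (proj_space I - W)"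

definition zariski_closure ::
  "'i set \<Rightarrow> ('i \<Rightarrow> complex) set set \<Rightarrow> ('i \<Rightarrow> complex) set set" where
  "zariski_closure I X = \<Inter>{Z. zariski_closed I Z \<and> X \<subseteq> Z}"

definition zariski_irreducible :: "'i set \<Rightarrow> ('i \<Rightarrow> complex) set set \<Rightarrow> bool" where
  "zariski_irreducible I X \<longleftrightarrow> X \<noteq> {} \<and>
     (\<forall>Z1 Z2. zariski_closed I Z1 \<and> zariski_closed I Z2 \<and> X \<subseteq> Z1 \<union> Z2 \<longrightarrow> X \<subseteq> Z1 \<or> X \<subseteq> Z2)"

definition quasi_projective :: "'i set \<Rightarrow> ('i \<Rightarrow> complex) set set \<Rightarrow> bool" where
  "quasi_projective I X \<longleftrightarrow> (\<exists>Z W. zariski_closed I Z \<and> zariski_open I W \<and> X = Z \<inter> W)"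


section \<open>Regular maps, birational equivalence, rational varieties\<close>

text \<open>A regular map is given, locally in the Zariski topology, by homogeneous polynomials of
  one common degree without common zero.\<close>

definition regular_map ::
  "'i set \<Rightarrow> ('i \<Rightarrow> complex) set set \<Rightarrow> 'j set \<Rightarrow> ('j \<Rightarrow> complex) set set \<Rightarrow>
   (('i \<Rightarrow> complex) set \<Rightarrow> ('j \<Rightarrow> complex) set) \<Rightarrow> bool" where
  "regular_map I X J Y \<phi> \<longleftrightarrow> \<phi> ` X \<subseteq> Y \<and>
     (\<forall>p\<in>X. \<exists>W n F. zariski_open I W \<and> p \<in> W \<and> (\<forall>j\<in>J. mpoly_homogeneous n (F j)) \<and>
        (\<forall>q\<in>X \<inter> W. \<forall>y\<in>q. (\<exists>j\<in>J. mpoly_eval (F j) y \<noteq> 0) \<and>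
           \<phi> q = proj_point J (\<lambda>j. mpoly_eval (F j) y)))"

definition biregular ::
  "'i set \<Rightarrow> ('i \<Rightarrow> complex) set set \<Rightarrow> 'j set \<Rightarrow> ('j \<Rightarrow> complex) set set \<Rightarrow> bool" where
  "biregular I X J Y \<longleftrightarrow>
     (\<exists>\<phi> \<psi>. regular_map I X J Y \<phi> \<and> regular_map J Y I X \<psi> \<and>
        (\<forall>p\<in>X. \<psi> (\<phi> p) = p) \<and> (\<forall>q\<in>Y. \<phi> (\<psi> q) = q))"

definition birational ::
  "'i set \<Rightarrow> ('i \<Rightarrow> complex) set set \<Rightarrow> 'j set \<Rightarrow> ('j \<Rightarrow> complex) set set \<Rightarrow> bool" where
  "birational I X J Y \<longleftrightarrow>
     quasi_projective I X \<and> zariski_irreducible I X \<and>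
     quasi_projective J Y \<and> zariski_irreducible J Y \<and>
     (\<exists>W V. zariski_open I W \<and> zariski_open J V \<and> X \<inter> W \<noteq> {} \<and> Y \<inter> V \<noteq> {} \<and>
        biregular I (X \<inter> W) J (Y \<inter> V))"

text \<open>Complex projective \<open>d\<close>-space has coordinates indexed by \<open>'d option\<close>, with \<open>None\<close> for the
  additional coordinate; complex affine \<open>d\<close>-space is the chart where that coordinate is
  nonzero.\<close>

definition affine_chart :: "('d::finite option \<Rightarrow> complex) set set" where
  "affine_chart = {proj_point UNIV (case_option 1 (\<lambda>k. x $ k)) | x :: complex ^ 'd. True}"

text \<open>The type argument records the dimension \<open>CARD('d)\<close>.\<close>

definition rational_variety ::
  "'d::finite itself \<Rightarrow> 'i set \<Rightarrow> ('i \<Rightarrow> complex) set set \<Rightarrow> bool" where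
  "rational_variety _ I X \<longleftrightarrow> zariski_closed I X \<and> zariski_irreducible I X \<and>
     birational (UNIV :: 'd option set) affine_chart I X"


section \<open>Linear subspaces of projective space\<close>

definition codim_plane :: "'i set \<Rightarrow> nat \<Rightarrow> ('i \<Rightarrow> complex) set set \<Rightarrow> bool" where
  "codim_plane I k L \<longleftrightarrow>
     (\<exists>V \<subseteq> coord_space I.
        module.subspace (\<lambda>(c::complex) y i. c * y i) V \<and>
        vector_space.dim (\<lambda>(c::complex) y i. c * y i) V + k = card I \<and>
        L = {p \<in> proj_space I. p \<subseteq> V})"


section \<open>Parametric patches\<close>

type_synonym 'd blending = "real ^ 'd \<Rightarrow> real ^ 'd \<Rightarrow> real"

primrec Ck_on :: "nat \<Rightarrow> (real ^ 'd::finite) set \<Rightarrow> (real ^ 'd \<Rightarrow> real) \<Rightarrow> bool" where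
  "Ck_on 0 S f \<longleftrightarrow> continuous_on S f"
| "Ck_on (Suc k) S f \<longleftrightarrow> f differentiable_on S \<and>
     (\<forall>i. Ck_on k S (\<lambda>x. frechet_derivative f (at x) (axis i 1)))"

text \<open>Smoothness on the closed polytope is understood in the least demanding sense: continuous
  on the polytope and infinitely differentiable in its interior.\<close>

definition smooth_on_polytope :: "(real ^ 'd::finite) set \<Rightarrow> (real ^ 'd \<Rightarrow> real) \<Rightarrow> bool" where
  "smooth_on_polytope D f \<longleftrightarrow> continuous_on D f \<and> (\<forall>k. Ck_on k (interior D) f)"

definition smooth_patch :: "(real ^ 'd::finite) set \<Rightarrow> 'd blending \<Rightarrow> bool" where
  "smooth_patch A \<beta> \<longleftrightarrow>
     (\<forall>a\<in>A. smooth_on_polytope (convex hull A) (\<beta> a)) \<and>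
     (\<forall>a\<in>A. \<forall>x\<in>convex hull A. 0 \<le> \<beta> a x) \<and>
     (\<forall>x\<in>convex hull A. \<exists>a\<in>A. \<beta> a x \<noteq> 0)"

definition self_homeo :: "'a::topological_space set \<Rightarrow> ('a \<Rightarrow> 'a) \<Rightarrow> bool" where
  "self_homeo D \<psi> \<longleftrightarrow> (\<exists>\<phi>. homeomorphism D D \<psi> \<phi>)"

definition reparam :: "'d blending \<Rightarrow> (real ^ 'd \<Rightarrow> real ^ 'd) \<Rightarrow> 'd blending" where
  "reparam \<beta> \<psi> = (\<lambda>a x. \<beta> a (\<psi> x))"

text \<open>Reparametrizing by a homeomorphism destroys smoothness, so the patches are the smooth
  ones together with their (merely continuous) reparametrizations.\<close>

definition patch :: "(real ^ 'd::finite) set \<Rightarrow> 'd blending \<Rightarrow> bool" where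
  "patch A \<beta> \<longleftrightarrow>
     (\<exists>\<gamma> \<psi>. smooth_patch A \<gamma> \<and> self_homeo (convex hull A) \<psi> \<and>
        (\<forall>a\<in>A. \<forall>x\<in>convex hull A. \<beta> a x = reparam \<gamma> \<psi> a x))"

definition normalized :: "(real ^ 'd) set \<Rightarrow> 'd blending \<Rightarrow> 'd blending" where
  "normalized A \<beta> = (\<lambda>a x. \<beta> a x / (\<Sum>b\<in>A. \<beta> b x))"

definition linear_precision :: "(real ^ 'd::finite) set \<Rightarrow> 'd blending \<Rightarrow> bool" where
  "linear_precision A \<beta> \<longleftrightarrow>
     (\<forall>f c. linear f \<longrightarrow>
        (\<forall>x\<in>convex hull A. f x + c = (\<Sum>a\<in>A. normalized A \<beta> a x * (f a + c))))"

definition taut_map :: "(real ^ 'd::finite) set \<Rightarrow> 'd blending \<Rightarrow> real ^ 'd \<Rightarrow> real ^ 'd" where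
  "taut_map A \<beta> x = (\<Sum>a\<in>A. normalized A \<beta> a x *\<^sub>R a)"

definition proper_patch :: "(real ^ 'd::finite) set \<Rightarrow> 'd blending \<Rightarrow> bool" where
  "proper_patch A \<beta> \<longleftrightarrow> self_homeo (convex hull A) (taut_map A \<beta>)"

text \<open>The denominator of a rational function may vanish at some points of the domain; equality
  is required where it does not.\<close>

definition rational_on :: "(real ^ 'd::finite) set \<Rightarrow> (real ^ 'd \<Rightarrow> real) \<Rightarrow> bool" where
  "rational_on D f \<longleftrightarrow>
     (\<exists>p q. q \<noteq> 0 \<and>
        (\<forall>x\<in>D. mpoly_eval q (($) x) \<noteq> 0 \<longrightarrow>
           f x = mpoly_eval p (($) x) / mpoly_eval q (($) x)))"

definition rational_linear_precision :: "(real ^ 'd::finite) set \<Rightarrow> 'd blending \<Rightarrow> bool" where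
  "rational_linear_precision A \<beta> \<longleftrightarrow> proper_patch A \<beta> \<and>
     (\<exists>\<psi>. self_homeo (convex hull A) \<psi> \<and> linear_precision A (reparam \<beta> \<psi>) \<and>
        (\<forall>a\<in>A. rational_on (convex hull A) (normalized A (reparam \<beta> \<psi>) a)))"


section \<open>The variety of a rational patch\<close>

text \<open>\<open>polynomial_blending A \<beta> P\<close>: the polynomials \<open>P a\<close> arise from a reparametrization of \<open>\<beta>\<close>
  with rational normalized blending functions by clearing a common denominator \<open>h\<close>.\<close>

definition polynomial_blending ::
  "(real ^ 'd::finite) set \<Rightarrow> 'd blending \<Rightarrow> (real ^ 'd \<Rightarrow> ('d, real) mpoly) \<Rightarrow> bool" where
  "polynomial_blending A \<beta> P \<longleftrightarrow>
     (\<exists>\<psi> h. self_homeo (convex hull A) \<psi> \<and> h \<noteq> 0 \<and>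
        (\<forall>a\<in>A. \<forall>x\<in>convex hull A. mpoly_eval h (($) x) \<noteq> 0 \<longrightarrow>
           normalized A (reparam \<beta> \<psi>) a x =
             mpoly_eval (P a) (($) x) / mpoly_eval h (($) x)))"

definition image_closure ::
  "(real ^ 'd::finite) set \<Rightarrow> (real ^ 'd \<Rightarrow> ('d, real) mpoly) \<Rightarrow>
   (real ^ 'd \<Rightarrow> complex) set set" where
  "image_closure A P = zariski_closure A
     {proj_point A (\<lambda>a. mpoly_eval (complexify (P a)) (($) x)) | x :: complex ^ 'd.
        \<exists>a\<in>A. mpoly_eval (complexify (P a)) (($) x) \<noteq> 0}"

text \<open>The closure does not depend on the choice of the rational reparametrization and of the
  denominator, because the real polytope is Zariski dense; hence the definite description.\<close>

definition patch_variety ::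
  "(real ^ 'd::finite) set \<Rightarrow> 'd blending \<Rightarrow> (real ^ 'd \<Rightarrow> complex) set set" where
  "patch_variety A \<beta> = (THE Y. \<exists>P. polynomial_blending A \<beta> P \<and> Y = image_closure A P)"


section \<open>The tautological projection\<close>

definition taut_vec ::
  "(real ^ 'd::finite) set \<Rightarrow> (real ^ 'd \<Rightarrow> complex) \<Rightarrow> 'd option \<Rightarrow> complex" where
  "taut_vec A y = case_option (\<Sum>a\<in>A. y a) (\<lambda>k. \<Sum>a\<in>A. y a * complex_of_real (a $ k))"

definition taut_center :: "(real ^ 'd::finite) set \<Rightarrow> (real ^ 'd \<Rightarrow> complex) set set" where
  "taut_center A = {p \<in> proj_space A. \<forall>y\<in>p. \<forall>j. taut_vec A y j = 0}"

text \<open>Meaningful only for points outside the center.\<close>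

definition taut_proj ::
  "(real ^ 'd::finite) set \<Rightarrow> (real ^ 'd \<Rightarrow> complex) set \<Rightarrow> ('d option \<Rightarrow> complex) set" where
  "taut_proj A p = (\<Union>y\<in>p. proj_point UNIV (taut_vec A y))"

text \<open>A plane \<open>L\<close> of codimension \<open>d\<close> containing the center is the closure of a fibre of the
  projection, so its parameter is the single point onto which \<open>L\<close> minus the center is
  projected.\<close>

definition almost_all_planes_through_center ::
  "(real ^ 'd::finite) set \<Rightarrow> ((real ^ 'd \<Rightarrow> complex) set set \<Rightarrow> bool) \<Rightarrow> bool" where
  "almost_all_planes_through_center A Q \<longleftrightarrow>
     (\<exists>U. zariski_open (UNIV :: 'd option set) U \<and> U \<noteq> {} \<and>
        (\<forall>L. codim_plane A CARD('d) L \<and> taut_center A \<subseteq> L \<and>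
             taut_proj A ` (L - taut_center A) \<subseteq> U \<longrightarrow> Q L))"

end

theory Submission
  imports Defs "HOL-Computational_Algebra.Polynomial"
begin

text \<open>
  Let \<open>P\<close> be the blending polynomials of the reparametrization with linear precision and \<open>H\<close> their
  common denominator. Linear precision says that the tautological projection sends \<open>P(x)\<close> to
  \<open>H(x) \<cdot> (1, x)\<close>: first for real \<open>x\<close> in the polytope, then as an identity of polynomials. Hence
  projecting and then applying the homogenized \<open>P\<close> is the identity on the image of the
  parametrization, so also on its Zariski closure wherever the homogenized \<open>H\<close> and the additional
  coordinate do not vanish on the projected point. On this open set the projection is therefore a
  birational inverse of \<open>P\<close>, and a point of the variety is determined by its projection; a plane of
  codimension \<open>d\<close> through the center is contracted to a single point.
\<close>

section \<open>Polynomial functions\<close>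

text \<open>The variety is a definite description, so its independence of the reparametrization and
  of the denominator has to be settled before its geometry. The criterion free of both: a form
  vanishes on the complex image iff it vanishes on the normalized blending functions over the real
  polytope. A denominator contributes only a power of itself, a reparametrization only permutes the
  points of the polytope, and the zeros of the denominator are bridged by continuity on the real
  side and by density on the complex side.

  The open set is dictated by homogenization: \<open>H(x) * (1, x)\<close> turns into
  \<open>Hh t / t None * t\<close>, a nonzero multiple of \<open>t\<close> precisely where
  \<open>t None * Hh t\<close> is nonzero.

  That a plane is contracted to a point is a dimension count: its linear space has dimension
  \<open>card A - d\<close>, the kernel of the projection has dimension at least
  \<open>card A - (d + 1)\<close>, so modulo the kernel at most one dimension is left.\<close>

definition mdegree :: "('i \<Rightarrow>\<^sub>0 nat) \<Rightarrow> nat" where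
  "mdegree m = (\<Sum>i\<in>Poly_Mapping.keys m. Poly_Mapping.lookup m i)"

definition monom_eval :: "('i \<Rightarrow>\<^sub>0 nat) \<Rightarrow> ('i \<Rightarrow> 'a::comm_semiring_1) \<Rightarrow> 'a" where
  "monom_eval m v = (\<Prod>i\<in>Poly_Mapping.keys m. v i ^ Poly_Mapping.lookup m i)"

text \<open>Polynomial functions with all monomials of degree in \<open>D\<close>: \<open>D = UNIV\<close> gives all polynomial
  functions and \<open>D = {n}\<close> the forms of degree \<open>n\<close>.\<close>

definition poly_in :: "nat set \<Rightarrow> (('i \<Rightarrow> 'a::comm_semiring_1) \<Rightarrow> 'a) \<Rightarrow> bool" where
  "poly_in D f \<longleftrightarrow> (\<exists>p. mdegree ` Poly_Mapping.keys p \<subseteq> D \<and> f = mpoly_eval p)"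

lemma mpoly_eval_alt:
  "mpoly_eval p v = (\<Sum>m\<in>Poly_Mapping.keys p. Poly_Mapping.lookup p m * monom_eval m v)"
  by (simp add: mpoly_eval_def monom_eval_def)

lemma mpoly_eval_superset:
  assumes "finite M" "Poly_Mapping.keys p \<subseteq> M"
  shows "mpoly_eval p v = (\<Sum>m\<in>M. Poly_Mapping.lookup p m * monom_eval m v)"
  unfolding mpoly_eval_alt using assms
  by (intro sum.mono_neutral_left) (auto simp: in_keys_iff)

lemma mpoly_eval_0 [simp]: "mpoly_eval 0 v = 0"
  by (simp add: mpoly_eval_def)

lemma mpoly_eval_add: "mpoly_eval (p + q) v = mpoly_eval p v + mpoly_eval q v"
proof -
  let ?M = "Poly_Mapping.keys p \<union> Poly_Mapping.keys q"
  have "Poly_Mapping.keys (p + q) \<subseteq> ?M" by (rule keys_add)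
  then show ?thesis
    by (simp add: mpoly_eval_superset[where M = ?M] lookup_add sum.distrib algebra_simps)
qed

lemma mpoly_eval_single: "mpoly_eval (Poly_Mapping.single m c) v = c * monom_eval m v"
  by (simp add: mpoly_eval_alt)

lemma mpoly_homogeneous_iff: "mpoly_homogeneous n p \<longleftrightarrow> mdegree ` Poly_Mapping.keys p \<subseteq> {n}"
  by (auto simp: mpoly_homogeneous_def mdegree_def)

lemma poly_in_eval: "poly_in UNIV (mpoly_eval p)"
  by (auto simp: poly_in_def)

lemma poly_in_form: "poly_in {n} f \<longleftrightarrow> (\<exists>p. mpoly_homogeneous n p \<and> f = mpoly_eval p)"
  by (auto simp: poly_in_def mpoly_homogeneous_iff)

lemma poly_in_mono: "poly_in D f \<Longrightarrow> D \<subseteq> E \<Longrightarrow> poly_in E f"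
  by (force simp: poly_in_def)

lemma mdegree_superset:
  "finite M \<Longrightarrow> Poly_Mapping.keys m \<subseteq> M \<Longrightarrow> mdegree m = (\<Sum>i\<in>M. Poly_Mapping.lookup m i)"
  unfolding mdegree_def by (intro sum.mono_neutral_left) (auto simp: in_keys_iff)

lemma monom_eval_superset:
  "finite M \<Longrightarrow> Poly_Mapping.keys m \<subseteq> M \<Longrightarrow> monom_eval m v = (\<Prod>i\<in>M. v i ^ Poly_Mapping.lookup m i)"
  unfolding monom_eval_def by (intro prod.mono_neutral_left) (auto simp: in_keys_iff)

lemma mdegree_add: "mdegree (m + m') = mdegree m + mdegree m'"
  using keys_add[of m m']
  by (simp add: mdegree_superset[where M = "Poly_Mapping.keys m \<union> Poly_Mapping.keys m'"]
      lookup_add sum.distrib)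

lemma monom_eval_add: "monom_eval (m + m') v = monom_eval m v * monom_eval m' v"
  using keys_add[of m m']
  by (simp add: monom_eval_superset[where M = "Poly_Mapping.keys m \<union> Poly_Mapping.keys m'"]
      lookup_add power_add prod.distrib)

section \<open>Closure of polynomial functions and forms under arithmetic and substitution\<close>

lemma poly_in_0: "poly_in D (\<lambda>v. 0)"
  unfolding poly_in_def by (rule exI[of _ 0]) (simp add: fun_eq_iff)

lemma poly_in_add:
  assumes "poly_in D f" "poly_in D g" shows "poly_in D (\<lambda>v. f v + g v)"
proof -
  from assms obtain p q where "mdegree ` Poly_Mapping.keys p \<subseteq> D" "f = mpoly_eval p"
    "mdegree ` Poly_Mapping.keys q \<subseteq> D" "g = mpoly_eval q"
    by (auto simp: poly_in_def)
  moreover from this have "mdegree ` Poly_Mapping.keys (p + q) \<subseteq> D" using keys_add[of p q] by blast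
  ultimately show ?thesis unfolding poly_in_def
    by (intro exI[of _ "p + q"]) (auto simp: mpoly_eval_add)
qed

lemma poly_in_sum:
  "(\<And>x. x \<in> X \<Longrightarrow> poly_in D (f x)) \<Longrightarrow> poly_in D (\<lambda>v. \<Sum>x\<in>X. f x v)"
  by (induction X rule: infinite_finite_induct) (auto intro: poly_in_0 poly_in_add)

lemma poly_in_monom: "mdegree m \<in> D \<Longrightarrow> poly_in D (\<lambda>v. c * monom_eval m v)"
  unfolding poly_in_def
  by (intro exI[of _ "Poly_Mapping.single m c"]) (auto simp: mpoly_eval_single)

text \<open>The last premise says that \<open>D + E\<close> lies in \<open>F\<close>, so that one
  rule covers both arbitrary polynomial functions and the addition of degrees of forms.\<close>

lemma poly_in_times:
  assumes "poly_in D f" "poly_in E g" "\<And>i j. i \<in> D \<Longrightarrow> j \<in> E \<Longrightarrow> i + j \<in> F"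
  shows "poly_in F (\<lambda>v. f v * g v)"
proof -
  from assms obtain p q where p: "mdegree ` Poly_Mapping.keys p \<subseteq> D" "f = mpoly_eval p"
    and q: "mdegree ` Poly_Mapping.keys q \<subseteq> E" "g = mpoly_eval q"
    by (auto simp: poly_in_def)
  have "(\<lambda>v. f v * g v) = (\<lambda>v. \<Sum>m\<in>Poly_Mapping.keys p. \<Sum>m'\<in>Poly_Mapping.keys q.
     (Poly_Mapping.lookup p m * Poly_Mapping.lookup q m') * monom_eval (m + m') v)"
    by (simp add: p q mpoly_eval_alt sum_product monom_eval_add algebra_simps)
  moreover have "poly_in F \<dots>"
    using p q assms(3) by (intro poly_in_sum poly_in_monom) (auto simp: mdegree_add)
  ultimately show ?thesis by simp
qed

lemma poly_in_const: "0 \<in> D \<Longrightarrow> poly_in D (\<lambda>v. c)"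
  using poly_in_monom[of 0 D c] by (simp add: mdegree_def monom_eval_def)

lemma poly_in_var: "1 \<in> D \<Longrightarrow> poly_in D (\<lambda>v. v i)"
  using poly_in_monom[of "Poly_Mapping.single i 1" D 1] by (simp add: mdegree_def monom_eval_def)

lemma poly_in_cmult: "poly_in D f \<Longrightarrow> poly_in D (\<lambda>v. c * f v)"
  by (rule poly_in_times[where D = "{0}"]) (auto intro: poly_in_const)

lemma poly_in_minus:
  fixes f :: "('i \<Rightarrow> 'a::comm_ring_1) \<Rightarrow> 'a"
  assumes "poly_in D f" "poly_in D g" shows "poly_in D (\<lambda>v. f v - g v)"
  using poly_in_add[OF assms(1) poly_in_cmult[OF assms(2), of "-1"]] by simp

lemma form_power: "poly_in {n} f \<Longrightarrow> poly_in {n * k} (\<lambda>v. f v ^ k)"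
proof (induction k)
  case (Suc k)
  then show ?case by (auto intro!: poly_in_times[where D = "{n}" and E = "{n * k}"])
qed (auto intro: poly_in_const)

lemma form_prod:
  "(\<And>x. x \<in> X \<Longrightarrow> poly_in {n x} (f x)) \<Longrightarrow> poly_in {\<Sum>x\<in>X. n x} (\<lambda>v. \<Prod>x\<in>X. f x v)"
proof (induction X rule: infinite_finite_induct)
  case (insert x X)
  then show ?case
    by (auto intro!: poly_in_times[where D = "{n x}" and E = "{sum n X}"])
qed (auto intro: poly_in_const)

lemma poly_in_power: "poly_in UNIV f \<Longrightarrow> poly_in UNIV (\<lambda>v. f v ^ k)"
  by (induction k) (auto intro: poly_in_const poly_in_times)

lemma poly_in_prod:
  "(\<And>x. x \<in> X \<Longrightarrow> poly_in UNIV (f x)) \<Longrightarrow> poly_in UNIV (\<lambda>v. \<Prod>x\<in>X. f x v)"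
  by (induction X rule: infinite_finite_induct)
    (auto intro: poly_in_const poly_in_times[where D = UNIV and E = UNIV])

lemma poly_compose:
  assumes "poly_in UNIV f" "\<And>i. poly_in UNIV (g i)"
  shows "poly_in UNIV (\<lambda>v. f (\<lambda>i. g i v))"
proof -
  from assms obtain p where "f = mpoly_eval p" by (auto simp: poly_in_def)
  then show ?thesis using assms(2) unfolding mpoly_eval_def
    by (auto intro!: poly_in_sum poly_in_cmult poly_in_prod poly_in_power)
qed

text \<open>Degrees multiply under substitution; the case \<open>k = 1\<close> pulls forms back
  along the tautological projection without changing their degree.\<close>

lemma form_compose:
  assumes "poly_in {n} f" "\<And>i. poly_in {k} (g i)"
  shows "poly_in {k * n} (\<lambda>v. f (\<lambda>i. g i v))"
proof -
  from assms obtain p where p: "mpoly_homogeneous n p" "f = mpoly_eval p" by (auto simp: poly_in_form)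
  have "poly_in {k * n} (\<lambda>v. \<Prod>i\<in>Poly_Mapping.keys m. g i v ^ Poly_Mapping.lookup m i)"
    if "m \<in> Poly_Mapping.keys p" for m
  proof -
    have "k * n = (\<Sum>i\<in>Poly_Mapping.keys m. k * Poly_Mapping.lookup m i)"
      using p(1) that by (auto simp: mpoly_homogeneous_def simp flip: sum_distrib_left)
    then show ?thesis using assms(2) by (auto intro!: form_prod form_power)
  qed
  then show ?thesis unfolding p(2) mpoly_eval_def
    by (auto intro!: poly_in_sum poly_in_cmult)
qed

section \<open>Scaling of forms and homogenization\<close>

lemma monom_eval_scale: "monom_eval m (\<lambda>i. c * v i) = c ^ mdegree m * monom_eval m v"
  by (simp add: monom_eval_def mdegree_def power_mult_distrib prod.distrib power_sum)

lemma form_scale: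
  assumes "poly_in {n} f" shows "f (\<lambda>i. c * v i) = c ^ n * f v"
proof -
  from assms obtain p where p: "mpoly_homogeneous n p" "f = mpoly_eval p" by (auto simp: poly_in_form)
  then show ?thesis
    by (auto simp: mpoly_eval_alt sum_distrib_left monom_eval_scale mpoly_homogeneous_iff
        algebra_simps intro!: sum.cong)
qed

text \<open>Every monomial is padded with a power of \<open>t None\<close> up to degree
  \<open>n\<close>. A degree bound is assumed, not an exact degree, so that several polynomials can
  be homogenized to one common degree.\<close>

lemma form_homogenize:
  fixes f :: "('i \<Rightarrow> 'a::field) \<Rightarrow> 'a"
  assumes "poly_in {..n} f"
  obtains F where "poly_in {n} F"
    "\<And>t. t None \<noteq> 0 \<Longrightarrow> F t = t None ^ n * f (\<lambda>k. t (Some k) / t None)"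
proof -
  from assms obtain p where p: "mdegree ` Poly_Mapping.keys p \<subseteq> {..n}" "f = mpoly_eval p"
    by (auto simp: poly_in_def)
  have var_power: "poly_in {k} (\<lambda>v::'i option \<Rightarrow> 'a. v j ^ k)" for j k
    using form_power[OF poly_in_var[of "{1}" j], of k] by simp
  define F where "F = (\<lambda>t::'i option \<Rightarrow> 'a. \<Sum>m\<in>Poly_Mapping.keys p. Poly_Mapping.lookup p m *
     (t None ^ (n - mdegree m) * (\<Prod>i\<in>Poly_Mapping.keys m. t (Some i) ^ Poly_Mapping.lookup m i)))"
  show ?thesis
  proof
    show "poly_in {n} F" unfolding F_def
    proof (intro poly_in_sum poly_in_cmult)
      fix m assume "m \<in> Poly_Mapping.keys p"
      then have "mdegree m \<le> n" using p by auto
      then show "poly_in {n} (\<lambda>v. v None ^ (n - mdegree m) *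
          (\<Prod>i\<in>Poly_Mapping.keys m. (v (Some i) :: 'a) ^ Poly_Mapping.lookup m i))"
        using var_power
        by (intro poly_in_times[where D = "{n - mdegree m}" and E = "{mdegree m}"])
          (auto simp: mdegree_def intro!: form_prod)
    qed
  next
    fix t :: "'i option \<Rightarrow> 'a" assume t: "t None \<noteq> 0"
    have "t None ^ n * monom_eval m (\<lambda>k. t (Some k) / t None) =
       t None ^ (n - mdegree m) * (\<Prod>i\<in>Poly_Mapping.keys m. t (Some i) ^ Poly_Mapping.lookup m i)"
      if "m \<in> Poly_Mapping.keys p" for m
    proof -
      have "mdegree m \<le> n" using p that by auto
      then have "t None ^ n = t None ^ (n - mdegree m) * t None ^ mdegree m"
        by (simp flip: power_add)
      moreover have "t None ^ mdegree m * monom_eval m (\<lambda>k. t (Some k) / t None) =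
          monom_eval m (\<lambda>k. t None * (t (Some k) / t None))"
        by (rule monom_eval_scale[symmetric])
      ultimately show ?thesis using t by (simp add: monom_eval_def mult.assoc)
    qed
    then show "F t = t None ^ n * f (\<lambda>k. t (Some k) / t None)"
      unfolding p mpoly_eval_alt sum_distrib_left F_def
      by (intro sum.cong) (auto simp: mult.left_commute)
  qed
qed

lemma poly_in_bounded:
  assumes "poly_in UNIV f" obtains n where "poly_in {..n} f"
proof -
  from assms obtain p where "f = mpoly_eval p" by (auto simp: poly_in_def)
  \<comment> \<open>For the zero polynomial \<open>Max\<close> is applied to the empty set, but then
    there is no monomial for the bound to constrain.\<close>
  then have "poly_in {..Max (mdegree ` Poly_Mapping.keys p)} f"
    by (auto simp: poly_in_def intro!: exI[of _ p])
  then show ?thesis by (rule that)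
qed

lemma poly_in_bounded_finite:
  assumes "finite X" "\<And>x. x \<in> X \<Longrightarrow> poly_in UNIV (f x)"
  obtains n where "\<And>x. x \<in> X \<Longrightarrow> poly_in {..n} (f x)"
proof -
  have "\<forall>x\<in>X. \<exists>n. poly_in {..n} (f x)" using poly_in_bounded assms(2) by metis
  then obtain N where N: "\<And>x. x \<in> X \<Longrightarrow> poly_in {..N x} (f x)" by metis
  have "poly_in {..Max (N ` X)} (f x)" if "x \<in> X" for x
    using N[OF that] by (rule poly_in_mono) (use that assms(1) in auto)
  then show ?thesis by (rule that)
qed

section \<open>Zeros of polynomial functions\<close>

lemma poly_along_line:
  fixes f :: "('i \<Rightarrow> 'a::comm_ring_1) \<Rightarrow> 'a"
  assumes "poly_in UNIV f"
  obtains q where "\<And>t. f (\<lambda>i. x i + t * y i) = poly q t"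
proof -
  from assms obtain p where p: "f = mpoly_eval p" by (auto simp: poly_in_def)
  show ?thesis
    by (rule that[of "\<Sum>m\<in>Poly_Mapping.keys p. smult (Poly_Mapping.lookup p m)
         (\<Prod>i\<in>Poly_Mapping.keys m. [:x i, y i:] ^ Poly_Mapping.lookup m i)"])
      (simp add: p mpoly_eval_def poly_sum poly_prod algebra_simps)
qed

text \<open>On the line through \<open>x\<close> (parameter 0) and \<open>y\<close> (parameter 1)
  both functions restrict to nonzero univariate polynomials, so their product is not identically
  zero. This is irreducibility of affine space in elementary form.\<close>

lemma poly_nonzero_common:
  fixes f g :: "('i \<Rightarrow> 'a::field_char_0) \<Rightarrow> 'a"
  assumes "poly_in UNIV f" "poly_in UNIV g" "f x \<noteq> 0" "g y \<noteq> 0"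
  obtains z where "f z \<noteq> 0" "g z \<noteq> 0"
proof -
  obtain p where p: "\<And>t. f (\<lambda>i. x i + t * (y i - x i)) = poly p t"
    using poly_along_line[OF assms(1), of x "\<lambda>i. y i - x i"] by blast
  obtain q where q: "\<And>t. g (\<lambda>i. x i + t * (y i - x i)) = poly q t"
    using poly_along_line[OF assms(2), of x "\<lambda>i. y i - x i"] by blast
  have "poly p 0 \<noteq> 0" "poly q 1 \<noteq> 0" using assms(3,4) by (simp_all flip: p q)
  then have "p * q \<noteq> 0" by auto
  then obtain t where "poly (p * q) t \<noteq> 0"
    using poly_all_0_iff_0 by blast
  then show ?thesis using that by (auto simp flip: p q)
qed

text \<open>Dedekind's argument: distinct monomials are distinct multiplicative characters, hence
  linearly independent, already on the real points.\<close>

lemma monomials_independent: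
  fixes c :: "('i \<Rightarrow>\<^sub>0 nat) \<Rightarrow> 'a::real_normed_field"
  assumes "finite M" "m \<in> M" "c m \<noteq> 0"
  shows "\<exists>x. (\<Sum>m\<in>M. c m * monom_eval m (\<lambda>i. of_real (x i))) \<noteq> 0"
  using assms
proof (induction "card M" arbitrary: M m c rule: less_induct)
  case less
  show ?case
  proof (rule ccontr)
    assume "\<not> ?thesis"
    then have z: "(\<Sum>m\<in>M. c m * monom_eval m (\<lambda>i. of_real (x i))) = 0" for x :: "'i \<Rightarrow> real"
      by auto
    show False
    proof (cases "M = {m}")
      case True
      then show False using z[of "\<lambda>_. 1"] less.prems by (simp add: monom_eval_def)
    next
      case False
      then obtain m' where m': "m' \<in> M" "m' \<noteq> m" using less.prems by auto
      then obtain i where i: "Poly_Mapping.lookup m' i \<noteq> Poly_Mapping.lookup m i"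
        by (meson poly_mapping_eqI)
      \<comment> \<open>Doubling the coordinate \<open>i\<close> alone multiplies the monomial
        \<open>k\<close> by 2 to the power of its exponent at \<open>i\<close>, and these factors
        distinguish \<open>m\<close> from \<open>m'\<close>.\<close>
      define u :: "'i \<Rightarrow> real" where "u = (\<lambda>j. if j = i then 2 else 1)"
      have u: "monom_eval k (\<lambda>i. of_real (u i)) = (2::'a) ^ Poly_Mapping.lookup k i"
        for k :: "'i \<Rightarrow>\<^sub>0 nat"
      proof -
        have "monom_eval k (\<lambda>i. of_real (u i)) =
            (\<Prod>j\<in>Poly_Mapping.keys k. if j = i then (2::'a) ^ Poly_Mapping.lookup k i else 1)"
          unfolding monom_eval_def u_def by (intro prod.cong) auto
        then show ?thesis by (simp add: in_keys_iff)
      qed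
      \<comment> \<open>These are the coefficients of the rescaled relation minus
        \<open>2 ^ lookup m' i\<close> times the original one: the term of \<open>m'\<close> cancels
        and that of \<open>m\<close> survives, so the induction applies to
        \<open>M - {m'}\<close>.\<close>
      define c' where "c' = (\<lambda>k. c k * (2 ^ Poly_Mapping.lookup k i - 2 ^ Poly_Mapping.lookup m' i))"
      have "(2::'a) ^ Poly_Mapping.lookup m i \<noteq> 2 ^ Poly_Mapping.lookup m' i"
      proof
        assume "(2::'a) ^ Poly_Mapping.lookup m i = 2 ^ Poly_Mapping.lookup m' i"
        then have "norm ((2::'a) ^ Poly_Mapping.lookup m i) = norm ((2::'a) ^ Poly_Mapping.lookup m' i)"
          by simp
        then show False using i by (simp add: norm_power)
      qed
      then have c'm: "c' m \<noteq> 0" using less.prems by (simp add: c'_def)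
      have "\<exists>x. (\<Sum>k\<in>M - {m'}. c' k * monom_eval k (\<lambda>i. of_real (x i))) \<noteq> 0"
        using less.prems m' c'm by (intro less.hyps[of _ m]) (auto simp del: card_Diff_insert card_Diff_singleton intro: card_Diff1_less)
      then obtain x where x: "(\<Sum>k\<in>M - {m'}. c' k * monom_eval k (\<lambda>i. of_real (x i))) \<noteq> 0" by blast
      have "c' m' = 0" by (simp add: c'_def)
      then have "(\<Sum>k\<in>M - {m'}. c' k * monom_eval k (\<lambda>i. of_real (x i))) =
          (\<Sum>k\<in>M. c' k * monom_eval k (\<lambda>i. of_real (x i)))"
        using less.prems by (intro sum.mono_neutral_left) auto
      also have "\<dots> = (\<Sum>k\<in>M. c k * monom_eval k (\<lambda>i. of_real (u i * x i))) -
          2 ^ Poly_Mapping.lookup m' i * (\<Sum>k\<in>M. c k * monom_eval k (\<lambda>i. of_real (x i)))"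
      proof -
        have "monom_eval k (\<lambda>i. of_real (u i * x i)) =
            2 ^ Poly_Mapping.lookup k i * monom_eval k (\<lambda>i. of_real (x i) :: 'a)"
          for k :: "'i \<Rightarrow>\<^sub>0 nat"
          using u[of k] by (simp add: monom_eval_def power_mult_distrib prod.distrib)
        then show ?thesis
          by (simp add: c'_def sum_distrib_left algebra_simps flip: sum_subtractf)
      qed
      also have "\<dots> = 0" using z by (simp only: mult_zero_right diff_self)
      finally show False using x by simp
    qed
  qed
qed

lemma mpoly_nonzero_real_point:
  fixes p :: "('i, 'a::real_normed_field) mpoly"
  assumes "p \<noteq> 0"
  shows "\<exists>x. mpoly_eval p (\<lambda>i. of_real (x i)) \<noteq> 0"
proof -
  from assms obtain m where "m \<in> Poly_Mapping.keys p" by (metis all_not_in_conv keys_eq_empty)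
  then show ?thesis unfolding mpoly_eval_alt
    by (intro monomials_independent[where m = m]) (auto simp: in_keys_iff)
qed

text \<open>Along the line the polynomial has only finitely many roots, while the interval of
  parameters is infinite.\<close>

lemma mpoly_nonzero_dense_segment:
  fixes p :: "('d::finite, 'a::real_normed_field) mpoly" and x y :: "real ^ 'd"
  assumes "mpoly_eval p (\<lambda>i. of_real (y $ i)) \<noteq> 0" "e > 0"
  obtains t where "0 < t" "t < e" "mpoly_eval p (\<lambda>i. of_real ((x + t *\<^sub>R (y - x)) $ i)) \<noteq> 0"
proof -
  obtain q where q: "\<And>t. mpoly_eval p (\<lambda>i. of_real (x $ i) + t * of_real (y $ i - x $ i)) = poly q t"
    using poly_along_line[OF poly_in_eval[of p], of "\<lambda>i. of_real (x $ i)" "\<lambda>i. of_real (y $ i - x $ i)"] by blast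
  have "poly q 1 \<noteq> 0" using assms(1) by (simp flip: q)
  then have "finite {t. poly q t = 0}" by (intro poly_roots_finite) auto
  then have "finite (of_real -` {t. poly q t = 0} :: real set)"
    by (rule finite_vimageI) (simp add: inj_on_def)
  moreover have "infinite {0<..<e}" using assms(2) by simp
  ultimately obtain t where "t \<in> {0<..<e}" "t \<notin> of_real -` {t. poly q t = 0}"
    by (meson finite_subset subsetI)
  then show ?thesis by (intro that[of t]) (auto simp flip: q)
qed

text \<open>A known point of nonvanishing may lie outside \<open>S\<close>, and \<open>x\<close> may
  be a boundary point from which a move towards it leaves \<open>S\<close>. So the point is first
  replaced by one in a ball inside \<open>S\<close>; moving from \<open>x\<close> towards the
  replacement stays in \<open>S\<close> by convexity.\<close>

lemma mpoly_nonzero_dense: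
  fixes p :: "('d::finite, 'a::real_normed_field) mpoly" and S :: "(real ^ 'd) set"
  assumes "p \<noteq> 0" "convex S" "interior S \<noteq> {}" "x \<in> S" "e > 0"
  obtains z where "z \<in> S" "dist x z < e" "mpoly_eval p (\<lambda>i. of_real (z $ i)) \<noteq> 0"
proof -
  have near: "\<exists>t. 0 < t \<and> t < 1 \<and> dist x (x + t *\<^sub>R (y - x)) < r \<and>
      mpoly_eval p (\<lambda>i. of_real ((x + t *\<^sub>R (y - x)) $ i)) \<noteq> 0"
    if y: "mpoly_eval p (\<lambda>i. of_real (y $ i)) \<noteq> 0" and r: "r > 0" for r and x y :: "real ^ 'd"
  proof -
    \<comment> \<open>The added 1 keeps the denominator positive when \<open>y = x\<close>; the
      minimum with 1 makes the new point a convex combination.\<close>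
    have pos: "min 1 (r / (norm (y - x) + 1)) > 0" using r by (simp add: add_nonneg_pos)
    obtain t where t: "0 < t" "t < min 1 (r / (norm (y - x) + 1))"
      "mpoly_eval p (\<lambda>i. of_real ((x + t *\<^sub>R (y - x)) $ i)) \<noteq> 0"
      using mpoly_nonzero_dense_segment[OF y pos] by blast
    have "t * (norm (y - x) + 1) < r" using t(2)
      by (simp add: less_divide_eq add_nonneg_pos)
    then have "dist x (x + t *\<^sub>R (y - x)) < r" using t(1)
      by (simp add: dist_norm distrib_left)
    then show ?thesis using t by auto
  qed
  obtain w where "mpoly_eval p (\<lambda>i. of_real (w i)) \<noteq> 0"
    using mpoly_nonzero_real_point[OF assms(1)] by blast
  then have w: "mpoly_eval p (\<lambda>i. of_real ((\<chi> i. w i) $ i)) \<noteq> 0" by simp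
  obtain c r where c: "r > 0" "ball c r \<subseteq> S" using assms(3)
    by (metis all_not_in_conv mem_interior)
  obtain t where t: "dist c (c + t *\<^sub>R ((\<chi> i. w i) - c)) < r"
    "mpoly_eval p (\<lambda>i. of_real ((c + t *\<^sub>R ((\<chi> i. w i) - c)) $ i)) \<noteq> 0"
    using near[OF w c(1)] by blast
  define v where "v = c + t *\<^sub>R ((\<chi> i. w i) - c)"
  have v: "v \<in> S" "mpoly_eval p (\<lambda>i. of_real (v $ i)) \<noteq> 0"
    using t c by (auto simp: v_def)
  obtain s where s: "0 < s" "s < 1" "dist x (x + s *\<^sub>R (v - x)) < e"
      "mpoly_eval p (\<lambda>i. of_real ((x + s *\<^sub>R (v - x)) $ i)) \<noteq> 0"
    using near[OF v(2) assms(5)] by blast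
  have "(1 - s) *\<^sub>R x + s *\<^sub>R v \<in> S" using assms v(1) s by (intro convexD) auto
  then show ?thesis using s by (intro that[of "x + s *\<^sub>R (v - x)"]) (auto simp: algebra_simps)
qed

section \<open>Passage from real to complex points\<close>

lemma lookup_complexify: "Poly_Mapping.lookup (complexify p) m = of_real (Poly_Mapping.lookup p m)"
  by (simp add: complexify_def Poly_Mapping.map.rep_eq when_def)

lemma keys_complexify: "Poly_Mapping.keys (complexify p) = Poly_Mapping.keys p"
  by (auto simp: in_keys_iff lookup_complexify)

lemma mpoly_eval_complexify:
  "mpoly_eval (complexify p) (\<lambda>i. complex_of_real (x i)) = of_real (mpoly_eval p x)"
  by (simp add: mpoly_eval_def keys_complexify lookup_complexify)

lemma poly_vanishing_complex:
  fixes f g :: "('i \<Rightarrow> complex) \<Rightarrow> complex"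
  assumes "poly_in UNIV f" "poly_in UNIV g" "g y \<noteq> 0" "\<And>v. g v \<noteq> 0 \<Longrightarrow> f v = 0"
  shows "f v = 0"
proof (rule ccontr)
  assume "f v \<noteq> 0"
  then obtain z where "f z \<noteq> 0" "g z \<noteq> 0"
    using poly_nonzero_common[OF assms(1,2)] assms(3) by blast
  then show False using assms(4) by blast
qed

text \<open>Multiplying \<open>f\<close> by the complexified \<open>h\<close> removes the
  exceptional set: the product vanishes at all real points of \<open>S\<close>, hence is the zero
  polynomial. So \<open>f\<close> vanishes wherever the complexified \<open>h\<close> does not, and
  therefore everywhere.\<close>

lemma poly_identity:
  fixes f :: "('d::finite \<Rightarrow> complex) \<Rightarrow> complex" and S :: "(real ^ 'd) set"
  assumes f: "poly_in UNIV f" and h: "h \<noteq> 0" and S: "convex S" "interior S \<noteq> {}"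
    and z: "\<And>x. x \<in> S \<Longrightarrow> mpoly_eval h (($) x) \<noteq> 0 \<Longrightarrow> f (\<lambda>i. of_real (x $ i)) = 0"
  shows "f v = 0"
proof -
  define g where "g = mpoly_eval (complexify h)"
  have g: "poly_in UNIV g" by (simp add: g_def poly_in_eval)
  have "poly_in UNIV (\<lambda>v. f v * g v)" by (rule poly_in_times[OF f g]) auto
  then obtain p where p: "\<And>v. f v * g v = mpoly_eval p v" by (auto simp: poly_in_def fun_eq_iff)
  obtain x0 where x0: "x0 \<in> S" using S(2) interior_subset by fastforce
  have "p = 0"
  proof (rule ccontr)
    assume "p \<noteq> 0"
    then obtain x where x: "x \<in> S" "mpoly_eval p (\<lambda>i. of_real (x $ i)) \<noteq> 0"
      using mpoly_nonzero_dense[OF _ S x0, of p 1] by auto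
    have "g (\<lambda>i. of_real (x $ i)) = of_real (mpoly_eval h (($) x))"
      using mpoly_eval_complexify[of h "($) x"] by (simp add: g_def)
    then show False using x z[of x] by (auto simp flip: p)
  qed
  then have fg: "f v * g v = 0" for v by (simp add: p)
  obtain w where "mpoly_eval h w \<noteq> 0" using mpoly_nonzero_real_point[OF h] by auto
  then have "g (\<lambda>i. of_real (w i)) \<noteq> 0" by (simp add: g_def mpoly_eval_complexify)
  then show ?thesis
  proof (rule poly_vanishing_complex[OF f g])
    show "f v = 0" if "g v \<noteq> 0" for v using fg[of v] that by simp
  qed
qed

section \<open>Projective sets\<close>

definition vanishes :: "(('i \<Rightarrow> complex) \<Rightarrow> complex) \<Rightarrow> ('i \<Rightarrow> complex) set \<Rightarrow> bool" where
  "vanishes f p \<longleftrightarrow> (\<forall>y\<in>p. f y = 0)"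

definition param_image ::
  "'i set \<Rightarrow> ('i \<Rightarrow> ('k \<Rightarrow> complex) \<Rightarrow> complex) \<Rightarrow> ('i \<Rightarrow> complex) set set" where
  "param_image I P = {proj_point I (\<lambda>i. P i v) | v. \<exists>i\<in>I. P i v \<noteq> 0}"

lemma proj_point_self: "y \<in> coord_space I \<Longrightarrow> y \<in> proj_point I y"
  by (auto simp: proj_point_def coord_space_def fun_eq_iff intro!: exI[of _ 1])

lemma proj_point_restrict: "(\<lambda>i. if i \<in> I then y i else 0) \<in> proj_point I y"
  by (auto simp: proj_point_def intro!: exI[of _ 1])

lemma proj_point_eqI:
  assumes "c \<noteq> 0" "\<And>i. i \<in> I \<Longrightarrow> z i = c * y i"
  shows "proj_point I z = proj_point I y"
proof -
  have "(\<lambda>i. if i \<in> I then b * z i else 0) = (\<lambda>i. if i \<in> I then (b * c) * y i else 0)" for b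
    using assms(2) by auto
  moreover have "(\<lambda>i. if i \<in> I then b * y i else 0) = (\<lambda>i. if i \<in> I then (b / c) * z i else 0)" for b
    using assms by auto
  ultimately show ?thesis using assms(1) unfolding proj_point_def
    by (auto intro: exI[of _ "_ * c"])
qed

lemma proj_space_memD:
  assumes "p \<in> proj_space I" "y \<in> p"
  shows "y \<in> coord_space I" "p = proj_point I y" "\<exists>i\<in>I. y i \<noteq> 0"
proof -
  obtain z i where z: "p = proj_point I z" "i \<in> I" "z i \<noteq> 0" using assms(1) by (auto simp: proj_space_def)
  obtain c where c: "c \<noteq> 0" "y = (\<lambda>i. if i \<in> I then c * z i else 0)"
    using assms(2) by (auto simp: z proj_point_def)
  show "y \<in> coord_space I" by (simp add: c coord_space_def)
  show "p = proj_point I y" unfolding z(1) by (rule sym, rule proj_point_eqI[of c]) (use c in auto)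
  show "\<exists>i\<in>I. y i \<noteq> 0" using z c by auto
qed

lemma proj_space_obtain:
  assumes "p \<in> proj_space I"
  obtains y where "y \<in> p" "y \<in> coord_space I" "p = proj_point I y" "\<exists>i\<in>I. y i \<noteq> 0"
proof -
  obtain z where "p = proj_point I z" using assms by (auto simp: proj_space_def)
  then have "(\<lambda>i. if i \<in> I then z i else 0) \<in> p" by (simp add: proj_point_restrict)
  then show ?thesis using proj_space_memD[OF assms] that by blast
qed

lemma proj_point_memD:
  "y \<in> coord_space I \<Longrightarrow> z \<in> proj_point I y \<Longrightarrow> \<exists>c. c \<noteq> 0 \<and> z = (\<lambda>i. c * y i)"
  by (force simp: proj_point_def coord_space_def fun_eq_iff)

text \<open>Homogeneity makes vanishing independent of the representative. The cut-off appears
  because a form may involve variables outside \<open>I\<close>, at which all representatives are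
  zero.\<close>

lemma vanishes_proj_point:
  assumes "poly_in {n} f"
  shows "vanishes f (proj_point I y) \<longleftrightarrow> f (\<lambda>i. if i \<in> I then y i else 0) = 0"
proof -
  have "f (\<lambda>i. if i \<in> I then c * y i else 0) = c ^ n * f (\<lambda>i. if i \<in> I then y i else 0)" for c
    using form_scale[OF assms, of c "\<lambda>i. if i \<in> I then y i else 0"]
    by (simp add: if_distrib cong: if_cong)
  then have "f z = 0" if "z \<in> proj_point I y" "f (\<lambda>i. if i \<in> I then y i else 0) = 0" for z
    using that by (auto simp: proj_point_def)
  then show ?thesis using proj_point_restrict[of I y] unfolding vanishes_def by blast
qed

lemma vanishes_iff:
  assumes "poly_in {n} f" "p \<in> proj_space I" "y \<in> p"
  shows "vanishes f p \<longleftrightarrow> f y = 0"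
proof -
  have "y = (\<lambda>i. if i \<in> I then y i else 0)"
    using proj_space_memD(1)[OF assms(2,3)] by (auto simp: coord_space_def fun_eq_iff)
  then show ?thesis
    using vanishes_proj_point[OF assms(1), of I y] proj_space_memD(2)[OF assms(2,3)] by simp
qed

section \<open>Zariski closed sets and closures\<close>

lemma zariski_closed_alt:
  "zariski_closed I Z \<longleftrightarrow> (\<exists>S. (\<forall>f\<in>S. \<exists>n. poly_in {n} f) \<and>
     Z = {p \<in> proj_space I. \<forall>f\<in>S. vanishes f p})" (is "_ \<longleftrightarrow> ?R")
proof
  assume "zariski_closed I Z"
  then obtain S where S: "\<forall>F\<in>S. \<exists>n. mpoly_homogeneous n F"
    "Z = {p \<in> proj_space I. \<forall>F\<in>S. \<forall>y\<in>p. mpoly_eval F y = 0}"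
    by (auto simp: zariski_closed_def)
  then show ?R
    by (intro exI[of _ "mpoly_eval ` S"]) (force simp: vanishes_def poly_in_form)
next
  assume ?R
  then obtain S where S: "\<forall>f\<in>S. \<exists>n. poly_in {n} f"
     "Z = {p \<in> proj_space I. \<forall>f\<in>S. vanishes f p}" by blast
  then show "zariski_closed I Z" unfolding zariski_closed_def
    by (intro exI[of _ "{F. (\<exists>n. mpoly_homogeneous n F) \<and> mpoly_eval F \<in> S}"])
      (force simp: vanishes_def poly_in_form)
qed

lemma zariski_closed_subset: "zariski_closed I Z \<Longrightarrow> Z \<subseteq> proj_space I"
  by (auto simp: zariski_closed_def)

lemma zariski_closed_proj_space: "zariski_closed I (proj_space I)"
  unfolding zariski_closed_def by (rule exI[of _ "{}"]) auto

lemma zariski_open_nonvanishing: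
  assumes "poly_in {n} f" shows "zariski_open I {p \<in> proj_space I. \<not> vanishes f p}"
  unfolding zariski_open_def zariski_closed_alt
  using assms by (auto intro!: exI[of _ "{f}"])

lemma zariski_open_proj_space: "zariski_open I (proj_space I)"
proof -
  have "poly_in {0} (\<lambda>v::'a \<Rightarrow> complex. 1)" by (rule poly_in_const) simp
  from zariski_open_nonvanishing[OF this, of I] show ?thesis
    by (rule back_subst[where P = "zariski_open I"])
      (auto simp: vanishes_def elim: proj_space_obtain)
qed

text \<open>Closed sets are cut out by forms, so the smallest one around \<open>X\<close> is cut out
  by all forms vanishing on \<open>X\<close>. In this shape closures can be compared through their
  forms, and homogeneous relations pass from \<open>X\<close> to its closure.\<close>

lemma zariski_closure_eq:
  assumes "X \<subseteq> proj_space I"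
  shows "zariski_closure I X =
    {p \<in> proj_space I. \<forall>f n. poly_in {n} f \<and> (\<forall>q\<in>X. vanishes f q) \<longrightarrow> vanishes f p}" (is "_ = ?C")
proof -
  have "zariski_closed I ?C" unfolding zariski_closed_alt
    by (rule exI[of _ "{f. \<exists>n. poly_in {n} f \<and> (\<forall>q\<in>X. vanishes f q)}"]) auto
  moreover have "X \<subseteq> ?C" using assms by auto
  moreover have "?C \<subseteq> Z" if Z: "zariski_closed I Z" and "X \<subseteq> Z" for Z
  proof -
    obtain S where "\<forall>f\<in>S. \<exists>n. poly_in {n} f" "Z = {p \<in> proj_space I. \<forall>f\<in>S. vanishes f p}"
      using Z by (auto simp: zariski_closed_alt)
    then show ?thesis using \<open>X \<subseteq> Z\<close> by blast
  qed
  ultimately show ?thesis unfolding zariski_closure_def by (intro equalityI Inter_lower Inter_greatest) auto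
qed

lemma zariski_closed_closure:
  assumes "X \<subseteq> proj_space I" shows "zariski_closed I (zariski_closure I X)"
  unfolding zariski_closure_eq[OF assms] zariski_closed_alt
  by (rule exI[of _ "{f. \<exists>n. poly_in {n} f \<and> (\<forall>q\<in>X. vanishes f q)}"]) auto

lemma zariski_closure_superset: "X \<subseteq> zariski_closure I X"
  by (auto simp: zariski_closure_def)

lemma zariski_closure_minimal: "zariski_closed I Z \<Longrightarrow> X \<subseteq> Z \<Longrightarrow> zariski_closure I X \<subseteq> Z"
  by (auto simp: zariski_closure_def)

lemma zariski_irreducible_closure:
  assumes "zariski_irreducible I X" shows "zariski_irreducible I (zariski_closure I X)"
  unfolding zariski_irreducible_def
proof (intro conjI allI impI)
  show "zariski_closure I X \<noteq> {}"
    using assms zariski_closure_superset[of X I] by (auto simp: zariski_irreducible_def)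
next
  fix Z1 Z2
  assume Z: "zariski_closed I Z1 \<and> zariski_closed I Z2 \<and> zariski_closure I X \<subseteq> Z1 \<union> Z2"
  then have "X \<subseteq> Z1 \<union> Z2" using zariski_closure_superset[of X I] by blast
  then have "X \<subseteq> Z1 \<or> X \<subseteq> Z2" using assms Z by (auto simp: zariski_irreducible_def)
  then show "zariski_closure I X \<subseteq> Z1 \<or> zariski_closure I X \<subseteq> Z2"
    using Z zariski_closure_minimal by blast
qed

lemma quasi_projective_closed: "zariski_closed I Z \<Longrightarrow> quasi_projective I Z"
  unfolding quasi_projective_def using zariski_open_proj_space zariski_closed_subset by blast

lemma quasi_projective_open: "zariski_open I W \<Longrightarrow> quasi_projective I W"
  unfolding quasi_projective_def zariski_open_def using zariski_closed_proj_space by blast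

section \<open>Images of polynomial parametrizations\<close>

lemma param_image_subset: "param_image I P \<subseteq> proj_space I"
  by (auto simp: param_image_def proj_space_def)

text \<open>If neither closed set contains the image, each has a form that is nonzero at some point
  of the image and so pulls back to a nonzero polynomial in the parameters. A parameter where both
  are nonzero has its image in neither set.\<close>

lemma param_image_irreducible:
  assumes P: "\<And>i. i \<in> I \<Longrightarrow> poly_in UNIV (P i)" and ne: "i0 \<in> I" "P i0 v0 \<noteq> 0"
  shows "zariski_irreducible I (param_image I P)"
  unfolding zariski_irreducible_def
proof (intro conjI allI impI)
  show "param_image I P \<noteq> {}" using ne by (auto simp: param_image_def)
next
  fix Z1 Z2
  assume Z: "zariski_closed I Z1 \<and> zariski_closed I Z2 \<and> param_image I P \<subseteq> Z1 \<union> Z2"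
  define Q where "Q = (\<lambda>v i. if i \<in> I then P i v else 0)"
  have Q: "poly_in UNIV (\<lambda>v. Q v i)" for i
    using P by (cases "i \<in> I") (auto simp: Q_def intro: poly_in_0)
  have sep: "\<exists>g v. poly_in UNIV g \<and> g v \<noteq> 0 \<and>
      (\<forall>w. g w \<noteq> 0 \<longrightarrow> proj_point I (\<lambda>i. P i w) \<notin> Z)"
    if Z: "zariski_closed I Z" and not: "\<not> param_image I P \<subseteq> Z" for Z
  proof -
    obtain S where S: "\<forall>f\<in>S. \<exists>n. poly_in {n} f" "Z = {p \<in> proj_space I. \<forall>f\<in>S. vanishes f p}"
      using Z by (auto simp: zariski_closed_alt)
    obtain v where v: "\<exists>i\<in>I. P i v \<noteq> 0" "proj_point I (\<lambda>i. P i v) \<notin> Z"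
      using not by (auto simp: param_image_def)
    then have "proj_point I (\<lambda>i. P i v) \<in> proj_space I" by (auto simp: proj_space_def)
    then obtain f n where f: "f \<in> S" "poly_in {n} f" "\<not> vanishes f (proj_point I (\<lambda>i. P i v))"
      using v(2) S by auto
    have "poly_in UNIV (\<lambda>v. f (Q v))" using poly_compose[OF poly_in_mono[OF f(2)] Q] by simp
    moreover have "vanishes f (proj_point I (\<lambda>i. P i w)) \<longleftrightarrow> f (Q w) = 0" for w
      using vanishes_proj_point[OF f(2)] by (simp add: Q_def)
    ultimately show ?thesis using f by (intro exI[of _ "\<lambda>v. f (Q v)"] exI[of _ v]) (auto simp: S)
  qed
  show "param_image I P \<subseteq> Z1 \<or> param_image I P \<subseteq> Z2"
  proof (rule ccontr)
    assume "\<not> (param_image I P \<subseteq> Z1 \<or> param_image I P \<subseteq> Z2)"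
    then have not: "\<not> param_image I P \<subseteq> Z1" "\<not> param_image I P \<subseteq> Z2" by auto
    obtain g1 v1 where g1: "poly_in UNIV g1" "g1 v1 \<noteq> 0"
      "\<And>w. g1 w \<noteq> 0 \<Longrightarrow> proj_point I (\<lambda>i. P i w) \<notin> Z1"
      using sep[of Z1] Z not by blast
    obtain g2 v2 where g2: "poly_in UNIV g2" "g2 v2 \<noteq> 0"
      "\<And>w. g2 w \<noteq> 0 \<Longrightarrow> proj_point I (\<lambda>i. P i w) \<notin> Z2"
      using sep[of Z2] Z not by blast
    obtain w where w: "g1 w \<noteq> 0" "g2 w \<noteq> 0" using poly_nonzero_common[OF g1(1) g2(1)] g1(2) g2(2) by blast
    have g12: "poly_in UNIV (\<lambda>v. g1 v * g2 v)" by (rule poly_in_times[OF g1(1) g2(1)]) simp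
    \<comment> \<open>Nonvanishing of \<open>P i0\<close> keeps \<open>u\<close> off the base locus,
      where the parametrization defines no point.\<close>
    obtain u where u: "g1 u * g2 u \<noteq> 0" "P i0 u \<noteq> 0"
      using poly_nonzero_common[OF g12 P[OF ne(1)], of w v0] w ne by auto
    then have "proj_point I (\<lambda>i. P i u) \<in> param_image I P" using ne by (auto simp: param_image_def)
    then show False using u g1(3)[of u] g2(3)[of u] Z by auto
  qed
qed

section \<open>Affine space inside projective space\<close>

lemma affine_chart_eq_param_image:
  "affine_chart = param_image (UNIV :: 'd::finite option set) (case_option (\<lambda>v. 1) (\<lambda>k v. v k))"
proof -
  have *: "(\<lambda>i. (case i of None \<Rightarrow> \<lambda>v. 1 | Some k \<Rightarrow> \<lambda>v. v k) v) = case_option (1::complex) v"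
    for v :: "'d \<Rightarrow> complex"
    by (auto simp: fun_eq_iff split: option.split)
  have nz: "\<exists>i\<in>UNIV. (case i of None \<Rightarrow> \<lambda>v. 1 | Some k \<Rightarrow> \<lambda>v. v k) v \<noteq> (0::complex)"
    for v :: "'d \<Rightarrow> complex"
    by (rule bexI[of _ None]) auto
  show ?thesis unfolding affine_chart_def param_image_def *
  proof (intro equalityI subsetI)
    fix p assume "p \<in> {proj_point UNIV (case_option 1 v) |v :: 'd \<Rightarrow> complex.
      \<exists>i\<in>UNIV. (case i of None \<Rightarrow> \<lambda>v. 1 | Some k \<Rightarrow> \<lambda>v. v k) v \<noteq> 0}"
    then obtain v :: "'d \<Rightarrow> complex" where "p = proj_point UNIV (case_option 1 (\<lambda>k. (\<chi> k. v k) $ k))"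
      by auto
    then show "p \<in> {proj_point UNIV (case_option 1 (($) x)) |x :: complex ^ 'd. True}" by blast
  qed (use nz in blast)
qed

text \<open>This description yields openness, the one as a parametrized image yields
  irreducibility.\<close>

lemma affine_chart_eq:
  "affine_chart = {p \<in> proj_space (UNIV :: 'd::finite option set). \<not> vanishes (\<lambda>t. t None) p}"
proof (intro equalityI subsetI)
  fix p :: "('d option \<Rightarrow> complex) set" assume "p \<in> affine_chart"
  then obtain x :: "complex ^ 'd" where p: "p = proj_point UNIV (case_option 1 (\<lambda>k. x $ k))"
    by (auto simp: affine_chart_def)
  have nz: "case_option 1 (\<lambda>k. x $ k) None \<noteq> (0::complex)" by simp
  have "case_option 1 (\<lambda>k. x $ k) \<in> p"
    unfolding p by (rule proj_point_self) (simp add: coord_space_def)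
  then have "\<not> vanishes (\<lambda>t. t None) p" using nz unfolding vanishes_def by blast
  moreover have "p \<in> proj_space UNIV" unfolding p proj_space_def using nz by blast
  ultimately show "p \<in> {p \<in> proj_space UNIV. \<not> vanishes (\<lambda>t. t None) p}" by blast
next
  fix p :: "('d option \<Rightarrow> complex) set"
  assume "p \<in> {p \<in> proj_space UNIV. \<not> vanishes (\<lambda>t. t None) p}"
  then obtain t where t: "p \<in> proj_space UNIV" "t \<in> p" "t None \<noteq> 0" by (auto simp: vanishes_def)
  have "proj_point UNIV (case_option 1 (\<lambda>k. (\<chi> k. t (Some k) / t None) $ k)) = proj_point UNIV t"
    using t(3) by (intro proj_point_eqI[of "1 / t None"]) (auto split: option.split)
  then show "p \<in> affine_chart" using proj_space_memD(2)[OF t(1,2)] unfolding affine_chart_def by blast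
qed

lemma affine_chart_irreducible: "zariski_irreducible (UNIV :: 'd::finite option set) affine_chart"
  unfolding affine_chart_eq_param_image
  by (rule param_image_irreducible[of _ _ None])
    (auto intro: poly_in_const poly_in_var split: option.split)

lemma affine_chart_quasi_projective: "quasi_projective (UNIV :: 'd::finite option set) affine_chart"
  unfolding affine_chart_eq
  by (intro quasi_projective_open zariski_open_nonvanishing[of 1] poly_in_var) simp

section \<open>The variety of a patch\<close>

lemma poly_in_continuous_on:
  fixes f :: "('i \<Rightarrow> 'a::real_normed_field) \<Rightarrow> 'a"
  assumes "poly_in D f" "\<And>i. continuous_on S (g i)"
  shows "continuous_on S (\<lambda>x. f (\<lambda>i. g i x))"
proof -
  from assms obtain p where "f = mpoly_eval p" by (auto simp: poly_in_def)
  then show ?thesis unfolding mpoly_eval_def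
    using assms(2) by (auto intro!: continuous_intros)
qed

lemma continuous_on_zero_dense:
  fixes F :: "'a::metric_space \<Rightarrow> 'b::real_normed_vector"
  assumes "continuous_on D F" "x \<in> D"
    and "\<And>e. e > 0 \<Longrightarrow> \<exists>y\<in>D. dist x y < e \<and> F y = 0"
  shows "F x = 0"
proof (rule ccontr)
  assume "F x \<noteq> 0"
  then have "norm (F x) > 0" by simp
  then obtain e where e: "e > 0" "\<And>y. y \<in> D \<Longrightarrow> dist y x < e \<Longrightarrow> dist (F y) (F x) < norm (F x)"
    using assms(1,2) unfolding continuous_on_iff by blast
  obtain y where y: "y \<in> D" "dist x y < e" "F y = 0" using assms(3)[OF e(1)] by blast
  then show False using e(2)[OF y(1)] by (simp add: dist_commute dist_norm)
qed

text \<open>In full dimension the interior is the relative interior, which is nonempty for a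
  nonempty convex set; the empty hull is ruled out by its affine dimension -1.\<close>

lemma full_dim_convex_hull_interior:
  fixes A :: "(real ^ 'd::finite) set"
  assumes "aff_dim (convex hull A) = int CARD('d)"
  shows "interior (convex hull A) \<noteq> {}"
  using interior_rel_interior_gen[of "convex hull A"] assms
    rel_interior_eq_empty[OF convex_convex_hull, of A]
  by (auto simp: aff_dim_empty)

lemma patch_sum_pos:
  assumes A: "finite A" and \<beta>: "patch A \<beta>" and x: "x \<in> convex hull A"
  shows "(\<Sum>a\<in>A. \<beta> a x) > 0"
proof -
  obtain \<gamma> \<psi> \<phi> where \<gamma>: "smooth_patch A \<gamma>" "homeomorphism (convex hull A) (convex hull A) \<psi> \<phi>"
    "\<And>a x. a \<in> A \<Longrightarrow> x \<in> convex hull A \<Longrightarrow> \<beta> a x = \<gamma> a (\<psi> x)"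
    using \<beta> by (auto simp: patch_def self_homeo_def reparam_def)
  have \<psi>x: "\<psi> x \<in> convex hull A" using \<gamma>(2) x by (auto simp: homeomorphism_def)
  then obtain a where "a \<in> A" "\<gamma> a (\<psi> x) \<noteq> 0" using \<gamma>(1) by (auto simp: smooth_patch_def)
  then show ?thesis using A \<psi>x x \<gamma> unfolding smooth_patch_def
    by (intro sum_pos2[of _ a]) (auto simp: less_le)
qed

lemma normalized_continuous_on:
  assumes A: "finite A" and \<beta>: "patch A \<beta>" and a: "a \<in> A"
  shows "continuous_on (convex hull A) (normalized A \<beta> a)"
proof -
  obtain \<gamma> \<psi> \<phi> where \<gamma>: "smooth_patch A \<gamma>" "homeomorphism (convex hull A) (convex hull A) \<psi> \<phi>"
    "\<And>a x. a \<in> A \<Longrightarrow> x \<in> convex hull A \<Longrightarrow> \<beta> a x = \<gamma> a (\<psi> x)"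
    using \<beta> by (auto simp: patch_def self_homeo_def reparam_def)
  have cont: "continuous_on (convex hull A) (\<beta> b)" if b: "b \<in> A" for b
  proof -
    have "continuous_on (convex hull A) (\<gamma> b)"
      using \<gamma>(1) b by (auto simp: smooth_patch_def smooth_on_polytope_def)
    then have "continuous_on (convex hull A) (\<lambda>x. \<gamma> b (\<psi> x))"
      by (rule continuous_on_compose2) (use \<gamma>(2) in \<open>auto simp: homeomorphism_def\<close>)
    then show ?thesis by (rule continuous_on_eq) (simp add: \<gamma>(3) b)
  qed
  show ?thesis unfolding normalized_def
  proof (intro continuous_on_divide continuous_on_sum ballI)
    show "(\<Sum>b\<in>A. \<beta> b x) \<noteq> 0" if "x \<in> convex hull A" for x
      using patch_sum_pos[OF A \<beta> that] by simp
  qed (use cont a in auto)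
qed

lemma normalized_reparam: "normalized A (reparam \<beta> \<psi>) a x = normalized A \<beta> a (\<psi> x)"
  by (simp add: normalized_def reparam_def)

lemma normalized_sum:
  "finite A \<Longrightarrow> patch A \<beta> \<Longrightarrow> x \<in> convex hull A \<Longrightarrow> (\<Sum>a\<in>A. normalized A \<beta> a x) = 1"
  using patch_sum_pos[of A \<beta> x] by (simp add: normalized_def flip: sum_divide_distrib)

definition complex_blending ::
  "(real ^ 'd \<Rightarrow> ('d, real) mpoly) \<Rightarrow> real ^ 'd \<Rightarrow> ('d \<Rightarrow> complex) \<Rightarrow> complex" where
  "complex_blending P a = mpoly_eval (complexify (P a))"

lemma complex_blending_real:
  "complex_blending P a (\<lambda>i. complex_of_real (x i)) = of_real (mpoly_eval (P a) x)"
  by (simp add: complex_blending_def mpoly_eval_complexify)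

lemma image_closure_eq:
  fixes A :: "(real ^ 'd::finite) set"
  shows "image_closure A P = zariski_closure A (param_image A (complex_blending P))"
proof -
  have "(\<exists>x :: complex ^ 'd. \<Phi> (($) x)) \<longleftrightarrow> (\<exists>v. \<Phi> v)" for \<Phi> :: "('d \<Rightarrow> complex) \<Rightarrow> bool"
  proof
    assume "\<exists>v. \<Phi> v"
    then obtain v where "\<Phi> (($) (\<chi> k. v k))" by (auto simp: vec_lambda_inverse)
    then show "\<exists>x. \<Phi> (($) x)" by blast
  qed blast
  from this[of "\<lambda>v. _ = proj_point A (\<lambda>a. complex_blending P a v) \<and> (\<exists>a\<in>A. complex_blending P a v \<noteq> 0)"]
  show ?thesis by (simp add: image_closure_def param_image_def complex_blending_def)
qed

text \<open>The right-hand side mentions neither the reparametrization nor the denominator nor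
  \<open>P\<close>, which is what makes the variety well defined.\<close>

lemma vanishes_patch_iff:
  fixes A :: "(real ^ 'd::finite) set"
  assumes A: "finite A" "interior (convex hull A) \<noteq> {}" and \<beta>: "patch A \<beta>"
    and P: "polynomial_blending A \<beta> P" and f: "poly_in {n} f"
  shows "(\<forall>q\<in>param_image A (complex_blending P). vanishes f q) \<longleftrightarrow>
    (\<forall>x\<in>convex hull A. f (\<lambda>a. if a \<in> A then of_real (normalized A \<beta> a x) else 0) = 0)"
    (is "?L \<longleftrightarrow> (\<forall>x\<in>_. ?f x = 0)")
proof -
  let ?D = "convex hull A" and ?P = "complex_blending P"
  obtain \<psi> \<phi> h where \<psi>: "homeomorphism ?D ?D \<psi> \<phi>" and h: "h \<noteq> 0"
    and Ph: "\<And>a x. a \<in> A \<Longrightarrow> x \<in> ?D \<Longrightarrow> mpoly_eval h (($) x) \<noteq> 0 \<Longrightarrow>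
       normalized A \<beta> a (\<psi> x) = mpoly_eval (P a) (($) x) / mpoly_eval h (($) x)"
    using P by (auto simp: polynomial_blending_def self_homeo_def normalized_reparam)
  have \<psi>D: "\<psi> ` ?D = ?D" and \<psi>_cont: "continuous_on ?D \<psi>" using \<psi> by (auto simp: homeomorphism_def)
  define g where "g v = f (\<lambda>a. if a \<in> A then ?P a v else 0)" for v
  have blend: "poly_in UNIV (?P a)" for a by (simp add: complex_blending_def poly_in_eval)
  have "poly_in UNIV f" using f by (rule poly_in_mono) simp
  then have g: "poly_in UNIV g"
    unfolding g_def
  proof (rule poly_compose)
    show "poly_in UNIV (\<lambda>v. if a \<in> A then ?P a v else 0)" for a
      using blend by (cases "a \<in> A") (auto intro: poly_in_0)
  qed
  have L: "?L \<longleftrightarrow> (\<forall>v. (\<exists>a\<in>A. ?P a v \<noteq> 0) \<longrightarrow> g v = 0)"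
    unfolding param_image_def g_def vanishes_proj_point[OF f, symmetric] by blast
  \<comment> \<open>Clearing the denominator scales the whole coordinate vector by the value of
    \<open>h\<close>, hence a form of degree \<open>n\<close> by its \<open>n\<close>-th
    power.\<close>
  have g_real: "g (\<lambda>i. of_real (x $ i)) = of_real (mpoly_eval h (($) x)) ^ n * ?f (\<psi> x)"
    if x: "x \<in> ?D" "mpoly_eval h (($) x) \<noteq> 0" for x
  proof -
    have "(\<lambda>a. if a \<in> A then ?P a (\<lambda>i. of_real (x $ i)) else 0) =
        (\<lambda>a. of_real (mpoly_eval h (($) x)) * (if a \<in> A then of_real (normalized A \<beta> a (\<psi> x)) else 0))"
      using x Ph complex_blending_real[of P _ "($) x"] by (auto simp: fun_eq_iff)
    then show ?thesis unfolding g_def using form_scale[OF f] by simp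
  qed
  show ?thesis
  proof
    assume ?L
    have z: "?f (\<psi> x) = 0" if x: "x \<in> ?D" "mpoly_eval h (($) x) \<noteq> 0" for x
    proof -
      have "\<psi> x \<in> ?D" using \<psi>D x by auto
      \<comment> \<open>The normalized functions sum to 1, so some coordinate is nonzero and the
        complex parametrization is defined at \<open>x\<close>.\<close>
      then have "(\<Sum>a\<in>A. normalized A \<beta> a (\<psi> x)) \<noteq> 0" using normalized_sum[OF A(1) \<beta>] by simp
      then obtain a where "a \<in> A" "normalized A \<beta> a (\<psi> x) \<noteq> 0"
        using sum.neutral by meson
      then have "a \<in> A" "?P a (\<lambda>i. of_real (x $ i)) \<noteq> 0"
        using x Ph complex_blending_real[of P a "($) x"] by auto
      then have "g (\<lambda>i. of_real (x $ i)) = 0" using \<open>?L\<close> L by blast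
      then show ?thesis using g_real[OF x] x by simp
    qed
    have cont: "continuous_on ?D (\<lambda>x. ?f (\<psi> x))"
    proof (rule poly_in_continuous_on[OF f])
      show "continuous_on ?D (\<lambda>x. if a \<in> A then complex_of_real (normalized A \<beta> a (\<psi> x)) else 0)" for a
        using continuous_on_compose2[OF normalized_continuous_on[OF A(1) \<beta>] \<psi>_cont, of a] \<psi>D
        by (cases "a \<in> A") (auto intro!: continuous_intros)
    qed
    \<comment> \<open>Zeros of \<open>h\<close> are limits of points of the polytope where
      \<open>h\<close> is nonzero, so continuity extends the equation to them; surjectivity of
      \<open>\<psi>\<close> then covers the whole polytope.\<close>
    have "?f (\<psi> x) = 0" if x: "x \<in> ?D" for x
    proof (rule continuous_on_zero_dense[OF cont x])
      fix e :: real assume "e > 0"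
      then obtain y where y: "y \<in> ?D" "dist x y < e" "mpoly_eval h (\<lambda>i. of_real (y $ i)) \<noteq> 0"
        using mpoly_nonzero_dense[OF h convex_convex_hull A(2) x] by blast
      then show "\<exists>y\<in>?D. dist x y < e \<and> ?f (\<psi> y) = 0"
        using z[OF y(1)] by (intro bexI[of _ y]) simp_all
    qed
    then have "?f y = 0" if "y \<in> \<psi> ` ?D" for y using that by blast
    then show "\<forall>x\<in>?D. ?f x = 0" unfolding \<psi>D by blast
  next
    assume R: "\<forall>x\<in>?D. ?f x = 0"
    have "g v = 0" for v
    proof (rule poly_identity[OF g h convex_convex_hull A(2)])
      fix x assume x: "x \<in> ?D" "mpoly_eval h (($) x) \<noteq> 0"
      have "\<psi> x \<in> ?D" using \<psi>D x by auto
      then show "g (\<lambda>i. of_real (x $ i)) = 0" using g_real[OF x] R by simp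
    qed
    then show ?L using L by blast
  qed
qed

text \<open>All admissible polynomials have the same vanishing forms and so the same closure; hence
  the definite description denotes the closure obtained from any one of them.\<close>

lemma patch_variety_eq:
  fixes A :: "(real ^ 'd::finite) set"
  assumes A: "finite A" "interior (convex hull A) \<noteq> {}" and \<beta>: "patch A \<beta>"
    and P: "polynomial_blending A \<beta> P"
  shows "patch_variety A \<beta> = zariski_closure A (param_image A (complex_blending P))"
proof -
  have "image_closure A Q = {p \<in> proj_space A. \<forall>f n. poly_in {n} f \<and>
      (\<forall>x\<in>convex hull A. f (\<lambda>a. if a \<in> A then of_real (normalized A \<beta> a x) else 0) = 0) \<longrightarrow>
      vanishes f p}" if "polynomial_blending A \<beta> Q" for Q
    unfolding image_closure_eq zariski_closure_eq[OF param_image_subset]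
    using vanishes_patch_iff[OF A \<beta> that] by blast
  then have "patch_variety A \<beta> = image_closure A P"
    unfolding patch_variety_def by (intro the_equality) (use P in blast)+
  then show ?thesis by (simp add: image_closure_eq)
qed

section \<open>Clearing denominators, and linear precision as polynomial identities\<close>

lemma common_denominator:
  fixes A :: "(real ^ 'd::finite) set"
  assumes A: "finite A" and r: "\<And>a. a \<in> A \<Longrightarrow> rational_on D (f a)"
  obtains h :: "('d, real) mpoly" and P where "h \<noteq> 0"
    "\<And>a x. a \<in> A \<Longrightarrow> x \<in> D \<Longrightarrow> mpoly_eval h (($) x) \<noteq> 0 \<Longrightarrow>
       f a x = mpoly_eval (P a) (($) x) / mpoly_eval h (($) x)"
proof -
  obtain p q where pq: "\<And>a. a \<in> A \<Longrightarrow> q a \<noteq> 0"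
    "\<And>a x. a \<in> A \<Longrightarrow> x \<in> D \<Longrightarrow> mpoly_eval (q a) (($) x) \<noteq> 0 \<Longrightarrow>
       f a x = mpoly_eval (p a) (($) x) / mpoly_eval (q a :: ('d, real) mpoly) (($) x)"
    using r unfolding rational_on_def by metis
  have prod: "poly_in UNIV (\<lambda>v. \<Prod>a\<in>B. mpoly_eval (q a) v)" for B
    by (intro poly_in_prod poly_in_eval)
  \<comment> \<open>That the product of the denominators is nonzero is shown by a point where all of
    them are nonzero, found by adding one denominator at a time.\<close>
  have "\<exists>v. (\<Prod>a\<in>B. mpoly_eval (q a) v) \<noteq> 0" if "B \<subseteq> A" for B
    using finite_subset[OF that A] that
  proof (induction B rule: finite_induct)
    case (insert b B)
    have "B \<subseteq> A" "q b \<noteq> 0" using insert.prems pq(1) by auto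
    obtain v where v: "(\<Prod>a\<in>B. mpoly_eval (q a) v) \<noteq> 0"
      using insert.IH[OF \<open>B \<subseteq> A\<close>] by blast
    obtain w where w: "mpoly_eval (q b) w \<noteq> 0"
      using mpoly_nonzero_real_point[OF \<open>q b \<noteq> 0\<close>] by auto
    obtain z where "(\<Prod>a\<in>B. mpoly_eval (q a) z) \<noteq> 0" "mpoly_eval (q b) z \<noteq> 0"
      by (rule poly_nonzero_common[OF prod[of B] poly_in_eval[of "q b"], OF v w])
    then show ?case using insert.hyps by (intro exI[of _ z]) simp
  qed simp
  then obtain v where v: "(\<Prod>a\<in>A. mpoly_eval (q a) v) \<noteq> 0" by blast
  obtain h where h: "\<And>v. (\<Prod>a\<in>A. mpoly_eval (q a) v) = mpoly_eval h v"
    using prod[of A] by (auto simp: poly_in_def fun_eq_iff)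
  have "poly_in UNIV (\<lambda>v. mpoly_eval (p a) v * (\<Prod>b\<in>A - {a}. mpoly_eval (q b) v))" for a
    by (rule poly_in_times[OF poly_in_eval prod]) simp
  then have "\<exists>P. \<forall>v. mpoly_eval (p a) v * (\<Prod>b\<in>A - {a}. mpoly_eval (q b) v) = mpoly_eval P v" for a
    by (auto simp: poly_in_def fun_eq_iff)
  then obtain P where P:
    "\<And>a v. mpoly_eval (p a) v * (\<Prod>b\<in>A - {a}. mpoly_eval (q b) v) = mpoly_eval (P a) v" by metis
  show ?thesis
  proof
    show "h \<noteq> 0" using v by (auto simp: h)
  next
    fix a x assume a: "a \<in> A" and x: "x \<in> D" and nz: "mpoly_eval h (($) x) \<noteq> 0"
    have "mpoly_eval (q a) (($) x) \<noteq> 0" "(\<Prod>b\<in>A - {a}. mpoly_eval (q b) (($) x)) \<noteq> 0"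
      using nz A a by (auto simp flip: h)
    then show "f a x = mpoly_eval (P a) (($) x) / mpoly_eval h (($) x)"
      using pq(2)[OF a x] by (simp add: prod.remove[OF A a] flip: P h)
  qed
qed

text \<open>Linear precision of the constant function 1 gives the first identity, that of the
  coordinate functions the second; together they compute the tautological projection of
  \<open>P\<close>.\<close>

lemma linear_precision_identities:
  fixes A :: "(real ^ 'd::finite) set"
  assumes int: "interior (convex hull A) \<noteq> {}" and lp: "linear_precision A \<beta>" and h: "h \<noteq> 0"
    and Ph: "\<And>a x. a \<in> A \<Longrightarrow> x \<in> convex hull A \<Longrightarrow> mpoly_eval h (($) x) \<noteq> 0 \<Longrightarrow>
       normalized A \<beta> a x = mpoly_eval (P a) (($) x) / mpoly_eval h (($) x)"
  shows "(\<Sum>a\<in>A. complex_blending P a v) = mpoly_eval (complexify h) v"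
    and "(\<Sum>a\<in>A. complex_blending P a v * of_real (a $ k)) = v k * mpoly_eval (complexify h) v"
proof -
  let ?H = "mpoly_eval (complexify h)" and ?D = "convex hull A"
  have blend: "poly_in UNIV (complex_blending P a)" for a by (simp add: complex_blending_def poly_in_eval)
  have affine: "(f x + c) * mpoly_eval h (($) x) = (\<Sum>a\<in>A. mpoly_eval (P a) (($) x) * (f a + c))"
    if "linear f" and x: "x \<in> ?D" "mpoly_eval h (($) x) \<noteq> 0" for f c x
  proof -
    have "f x + c = (\<Sum>a\<in>A. normalized A \<beta> a x * (f a + c))"
      using lp that by (auto simp: linear_precision_def)
    also have "\<dots> = (\<Sum>a\<in>A. mpoly_eval (P a) (($) x) * (f a + c)) / mpoly_eval h (($) x)"
      unfolding sum_divide_distrib by (intro sum.cong) (use Ph x in auto)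
    finally show ?thesis using x(2) by simp
  qed
  have H_real: "?H (\<lambda>i. of_real (x $ i)) = of_real (mpoly_eval h (($) x))"
    and P_real: "complex_blending P a (\<lambda>i. of_real (x $ i)) = of_real (mpoly_eval (P a) (($) x))" for x a
    using mpoly_eval_complexify[of h "($) x"] complex_blending_real[of P a "($) x"] by auto
  have "poly_in UNIV (\<lambda>v. (\<Sum>a\<in>A. complex_blending P a v) - ?H v)"
    by (intro poly_in_minus poly_in_sum blend poly_in_eval)
  from poly_identity[OF this h convex_convex_hull int, of v]
  show "(\<Sum>a\<in>A. complex_blending P a v) = ?H v"
    using affine[of "\<lambda>_. 0" _ 1] by (simp add: H_real P_real linear_zero flip: of_real_sum)
  have "poly_in UNIV (\<lambda>v. (\<Sum>a\<in>A. of_real (a $ k) * complex_blending P a v) - v k * ?H v)"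
    by (intro poly_in_minus poly_in_sum poly_in_cmult blend
        poly_in_times[OF poly_in_var[of UNIV] poly_in_eval]) auto
  from poly_identity[OF this h convex_convex_hull int, of v]
  show "(\<Sum>a\<in>A. complex_blending P a v * of_real (a $ k)) = v k * ?H v"
    using affine[of "\<lambda>x. x $ k" _ 0]
    by (simp add: H_real P_real bounded_linear.linear[OF bounded_linear_vec_nth] mult.commute
        flip: of_real_sum of_real_mult)
qed

section \<open>Planes through the center\<close>

interpretation cfun: vector_space "\<lambda>(c::complex) (y :: 'i \<Rightarrow> complex) i. c * y i"
  by unfold_locales (auto simp: fun_eq_iff algebra_simps)

lemma subspace_coord_space: "cfun.subspace (coord_space I)"
  by (auto simp: cfun.subspace_def coord_space_def)

text \<open>The space of all functions on the index type can be infinite-dimensional, so dimensions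
  are controlled by an explicit finite basis of the functions supported on \<open>I\<close>. It is
  used in two ways: as a spanning set it bounds independent sets, and as an independent set it
  bounds spanning sets.\<close>

lemma coord_space_basis:
  assumes "finite I"
  shows "\<exists>B. finite B \<and> card B = card I \<and> B \<subseteq> coord_space I \<and> cfun.independent B \<and>
    coord_space I \<subseteq> cfun.span B"
  using assms
proof (induction I rule: finite_induct)
  case empty
  have "coord_space {} = {0 :: 'a \<Rightarrow> complex}" by (auto simp: coord_space_def fun_eq_iff)
  then show ?case by (intro exI[of _ "{}"]) (simp add: cfun.independent_empty)
next
  case (insert i I)
  then obtain B where B: "finite B" "card B = card I" "B \<subseteq> coord_space I" "cfun.independent B"
    "coord_space I \<subseteq> cfun.span B" by blast
  define u :: "'a \<Rightarrow> complex" where "u = (\<lambda>j. if j = i then 1 else 0)"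
  have "cfun.span B \<subseteq> coord_space I" using B(3) subspace_coord_space by (rule cfun.span_minimal)
  moreover have "u \<notin> coord_space I" using insert.hyps by (auto simp: u_def coord_space_def)
  ultimately have u: "u \<notin> cfun.span B" by blast
  have "u \<notin> B" using u cfun.span_base by blast
  have ind: "cfun.independent (insert u B)" using u B(4) by (rule cfun.independent_insertI)
  have "y \<in> cfun.span (insert u B)" if y: "y \<in> coord_space (insert i I)" for y
  proof -
    have "y(i := 0) \<in> coord_space I" using y by (auto simp: coord_space_def)
    moreover have "y - (\<lambda>j. y i * u j) = y(i := 0)" by (auto simp: u_def fun_eq_iff)
    ultimately have "y - (\<lambda>j. y i * u j) \<in> cfun.span B" using B(5) by auto
    then show ?thesis unfolding cfun.span_insert by blast
  qed
  moreover have "u \<in> coord_space (insert i I)" "coord_space I \<subseteq> coord_space (insert i I)"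
    by (auto simp: u_def coord_space_def)
  ultimately show ?case using B insert.hyps \<open>u \<notin> B\<close>
    by (intro exI[of _ "insert u B"]) (auto simp del: cfun.independent_insert simp: ind)
qed

lemma independent_card_le:
  assumes "finite I" "cfun.independent S" "S \<subseteq> coord_space I"
  shows "finite S \<and> card S \<le> card I"
proof -
  obtain B where B: "finite B" "card B = card I" "coord_space I \<subseteq> cfun.span B"
    using coord_space_basis[OF assms(1)] by blast
  have "S \<subseteq> cfun.span B" using assms(3) B(3) by blast
  then show ?thesis using cfun.independent_span_bound[OF B(1) assms(2)] B(2) by simp
qed

section \<open>Dimension count for planes containing the center\<close>

lemma taut_vec_linear:
  "Vector_Spaces.linear (\<lambda>(c::complex) y i. c * y i) (\<lambda>(c::complex) y i. c * y i) (taut_vec A)"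
  by unfold_locales
    (auto simp: fun_eq_iff taut_vec_def algebra_simps sum.distrib sum_distrib_left split: option.split)

text \<open>Otherwise \<open>y\<close> and \<open>z\<close> are independent modulo the kernel, which
  \<open>V\<close> contains, so \<open>dim V\<close> exceeds the dimension of the kernel by at least
  2. But the kernel has codimension at most \<open>CARD('d) + 1\<close> and \<open>V\<close> has
  codimension \<open>CARD('d)\<close>, which leaves room for 1 only.\<close>

lemma taut_vec_plane_dependent:
  fixes A :: "(real ^ 'd::finite) set"
  assumes A: "finite A" and V: "cfun.subspace V" "V \<subseteq> coord_space A"
    and dim: "cfun.dim V + CARD('d) = card A"
    and E: "\<And>y. y \<in> coord_space A \<Longrightarrow> taut_vec A y = 0 \<Longrightarrow> y \<in> V"
    and yz: "y \<in> V" "z \<in> V" "taut_vec A z \<noteq> 0"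
  shows "\<exists>c. taut_vec A y = (\<lambda>j. c * taut_vec A z j)"
proof (rule ccontr)
  assume neg: "\<not> ?thesis"
  interpret T: Vector_Spaces.linear "\<lambda>(c::complex) y i. c * y i" "\<lambda>(c::complex) y i. c * y i" "taut_vec A"
    by (rule taut_vec_linear)
  define N where "N = {y \<in> coord_space A. taut_vec A y = 0}"
  have "N = coord_space A \<inter> {y. taut_vec A y = 0}" by (auto simp: N_def)
  then have N: "cfun.subspace N"
    using cfun.subspace_inter[OF subspace_coord_space T.subspace_kernel] by simp
  obtain B where B: "B \<subseteq> N" "cfun.independent B" "N \<subseteq> cfun.span B"
    by (rule cfun.maximal_independent_subset)
  have BN: "cfun.span B \<subseteq> N" using B(1) N by (rule cfun.span_minimal)
  have BV: "B \<subseteq> V" using B(1) E by (auto simp: N_def)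
  have z: "z \<notin> cfun.span B" using BN yz by (auto simp: N_def)
  have y: "y \<notin> cfun.span (insert z B)"
  proof
    assume "y \<in> cfun.span (insert z B)"
    then obtain k where "y - (\<lambda>i. k * z i) \<in> cfun.span B" unfolding cfun.span_insert by blast
    then have "taut_vec A (y - (\<lambda>i. k * z i)) = 0" using BN by (auto simp: N_def)
    then have "taut_vec A y = (\<lambda>i. k * taut_vec A z i)" by (simp add: T.diff T.scale)
    then show False using neg by blast
  qed
  have ind: "cfun.independent (insert y (insert z B))"
    by (intro cfun.independent_insertI y z B)
  have sub: "insert y (insert z B) \<subseteq> V" using yz BV by simp
  have finB: "finite B" using independent_card_le[OF A B(2)] BV V(2) by blast
  have "z \<notin> B" "y \<notin> insert z B" using z y cfun.span_base by blast+
  then have card: "card (insert y (insert z B)) = card B + 2" using finB by simp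
  obtain C where C: "C \<subseteq> V" "cfun.independent C" "V \<subseteq> cfun.span C" "card C = cfun.dim V"
    by (rule cfun.basis_exists)
  have C_fin: "finite C" using independent_card_le[OF A C(2)] C(1) V(2) by blast
  have "insert y (insert z B) \<subseteq> cfun.span C" using sub C(3) by (rule order_trans)
  then have le: "card B + 2 \<le> cfun.dim V"
    using cfun.independent_span_bound[OF C_fin ind] C(4) card by simp
  \<comment> \<open>Rank-nullity by hand: a basis of the image has at most
    \<open>CARD('d) + 1\<close> elements, and lifts of it together with the basis \<open>B\<close>
    of the kernel span the coordinate space.\<close>
  obtain D where D: "D \<subseteq> taut_vec A ` coord_space A" "cfun.independent D"
      "taut_vec A ` coord_space A \<subseteq> cfun.span D"
    by (rule cfun.maximal_independent_subset)
  have D_fin: "finite D" "card D \<le> CARD('d) + 1"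
  proof -
    have "D \<subseteq> coord_space UNIV" by (simp add: coord_space_def)
    then have "finite D \<and> card D \<le> card (UNIV :: 'd option set)"
      using D(2) by (intro independent_card_le) simp_all
    then show "finite D" "card D \<le> CARD('d) + 1" by simp_all
  qed
  obtain D' where D': "D' \<subseteq> coord_space A" "finite D'" "card D' = card D" "D = taut_vec A ` D'"
  proof -
    obtain U where U: "U \<subseteq> coord_space A" "inj_on (taut_vec A) U" "D = taut_vec A ` U"
      using D(1) unfolding subset_image_inj by blast
    then have "finite U" "card U = card D" using D_fin(1) by (simp_all add: finite_image_iff card_image)
    then show ?thesis using that U by blast
  qed
  have "x \<in> cfun.span (B \<union> D')" if x: "x \<in> coord_space A" for x
  proof -
    have "taut_vec A x \<in> taut_vec A ` cfun.span D'"
      using D(3) x unfolding D'(4) T.span_image by blast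
    then obtain w where w: "w \<in> cfun.span D'" "taut_vec A x = taut_vec A w" by blast
    have "w \<in> coord_space A" using cfun.span_minimal[OF D'(1) subspace_coord_space] w(1) by blast
    then have "x - w \<in> coord_space A" using x subspace_coord_space cfun.subspace_diff by blast
    then have "x - w \<in> cfun.span B" using B(3) w(2) by (auto simp: N_def T.diff)
    then have "x - w \<in> cfun.span (B \<union> D')" "w \<in> cfun.span (B \<union> D')"
      using w(1) cfun.span_mono[of _ "B \<union> D'"] by blast+
    then have "x - w + w \<in> cfun.span (B \<union> D')" by (rule cfun.span_add)
    then show ?thesis by simp
  qed
  then have span: "coord_space A \<subseteq> cfun.span (B \<union> D')" by blast
  obtain F where F: "card F = card A" "F \<subseteq> coord_space A" "cfun.independent F"
    using coord_space_basis[OF A] by blast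
  have "card F \<le> card (B \<union> D')"
    using cfun.independent_span_bound[OF _ F(3), of "B \<union> D'"] F(2) span finB D'(2) by auto
  also have "\<dots> \<le> card B + (CARD('d) + 1)" using card_Un_le[of B D'] D'(3) D_fin(2) by simp
  finally show False using le dim F(1) by simp
qed

section \<open>The tautological projection is inverse to the parametrization\<close>

lemma taut_vec_scale: "taut_vec A (\<lambda>a. c * y a) = (\<lambda>j. c * taut_vec A y j)"
  by (auto simp: fun_eq_iff taut_vec_def sum_distrib_left mult.assoc split: option.split)

lemma taut_vec_cong: "(\<And>a. a \<in> A \<Longrightarrow> y a = z a) \<Longrightarrow> taut_vec A y = taut_vec A z"
  by (auto simp: fun_eq_iff taut_vec_def split: option.split)

lemma form_taut_vec: "poly_in {1} (\<lambda>y. taut_vec A y j)"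
proof (cases j)
  case None
  then show ?thesis unfolding taut_vec_def by (auto intro!: poly_in_sum poly_in_var)
next
  case (Some k)
  have "poly_in {1} (\<lambda>y. \<Sum>a\<in>A. complex_of_real (a $ k) * y a)"
    by (intro poly_in_sum poly_in_cmult poly_in_var) simp
  then show ?thesis unfolding taut_vec_def by (simp add: Some mult.commute)
qed

lemma taut_proj_eq:
  assumes "p \<in> proj_space A" "y \<in> p"
  shows "taut_proj A p = proj_point UNIV (taut_vec A y)"
proof -
  have "proj_point UNIV (taut_vec A z) = proj_point UNIV (taut_vec A y)" if "z \<in> p" for z
  proof -
    have "z \<in> proj_point A y" "y \<in> coord_space A"
      using that proj_space_memD[OF assms] by auto
    then obtain c where "c \<noteq> 0" "z = (\<lambda>a. c * y a)" using proj_point_memD by blast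
    then show ?thesis by (intro proj_point_eqI[of c]) (simp_all add: taut_vec_scale)
  qed
  then show ?thesis unfolding taut_proj_def using assms(2) by blast
qed

text \<open>For maps given by one family of forms on their whole domain, the open neighbourhood of
  each point can be the entire projective space.\<close>

lemma regular_map_formsI:
  assumes "\<phi> ` X \<subseteq> Y" "X \<subseteq> proj_space I" "\<And>j. j \<in> J \<Longrightarrow> poly_in {n} (f j)"
    and "\<And>q y. q \<in> X \<Longrightarrow> y \<in> q \<Longrightarrow> (\<exists>j\<in>J. f j y \<noteq> 0) \<and> \<phi> q = proj_point J (\<lambda>j. f j y)"
  shows "regular_map I X J Y \<phi>"
proof -
  have "\<forall>j\<in>J. \<exists>F. mpoly_homogeneous n F \<and> f j = mpoly_eval F"
    using assms(3) by (auto simp: poly_in_form)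
  then obtain F where F: "\<And>j. j \<in> J \<Longrightarrow> mpoly_homogeneous n (F j) \<and> f j = mpoly_eval (F j)" by metis
  have eq: "proj_point J (\<lambda>j. f j y) = proj_point J (\<lambda>j. mpoly_eval (F j) y)" for y
    by (rule proj_point_eqI[of 1]) (use F in auto)
  show ?thesis unfolding regular_map_def
  proof (intro conjI ballI exI)
    show "zariski_open I (proj_space I)" by (rule zariski_open_proj_space)
    show "\<phi> q = proj_point J (\<lambda>j. mpoly_eval (F j) y)" if "q \<in> X \<inter> proj_space I" "y \<in> q" for q y
      using assms(4) that eq by blast
    show "\<exists>j\<in>J. mpoly_eval (F j) y \<noteq> 0" if q: "q \<in> X \<inter> proj_space I" "y \<in> q" for q y
    proof -
      obtain j where "j \<in> J" "f j y \<noteq> 0" using assms(4) q by blast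
      then show ?thesis using F by auto
    qed
  qed (use assms(1,2) F in auto)
qed

text \<open>The blending functions \<open>P\<close> have linear precision up to the common factor \<open>H\<close>; \<open>Ph\<close> and
  \<open>Hh\<close> are their homogenizations of one common degree.\<close>

locale projective_blending =
  fixes A :: "(real ^ 'd::finite) set"
    and P :: "real ^ 'd \<Rightarrow> ('d \<Rightarrow> complex) \<Rightarrow> complex" and H :: "('d \<Rightarrow> complex) \<Rightarrow> complex"
    and n :: nat
    and Ph :: "real ^ 'd \<Rightarrow> ('d option \<Rightarrow> complex) \<Rightarrow> complex" and Hh :: "('d option \<Rightarrow> complex) \<Rightarrow> complex"
  assumes P_poly: "\<And>a. a \<in> A \<Longrightarrow> poly_in UNIV (P a)"
    and P_sum: "\<And>v. (\<Sum>a\<in>A. P a v) = H v"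
    and P_moment: "\<And>v k. (\<Sum>a\<in>A. P a v * of_real (a $ k)) = v k * H v"
    and H_nonzero: "\<exists>v. H v \<noteq> 0"
    and Ph_form: "\<And>a. a \<in> A \<Longrightarrow> poly_in {n} (Ph a)" and Hh_form: "poly_in {n} Hh"
    and Ph_eq: "\<And>a t. a \<in> A \<Longrightarrow> t None \<noteq> 0 \<Longrightarrow> Ph a t = t None ^ n * P a (\<lambda>k. t (Some k) / t None)"
    and Hh_eq: "\<And>t. t None \<noteq> 0 \<Longrightarrow> Hh t = t None ^ n * H (\<lambda>k. t (Some k) / t None)"
begin

definition variety :: "(real ^ 'd \<Rightarrow> complex) set set" where
  "variety = zariski_closure A (param_image A P)"

text \<open>The factor \<open>t None\<close> makes affine coordinates available; the factor
  \<open>Hh t\<close> makes the projection of the homogenized blending vector nonzero.\<close>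

definition chart_form :: "('d option \<Rightarrow> complex) \<Rightarrow> complex" where
  "chart_form t = t None * Hh t"

definition source_open :: "('d option \<Rightarrow> complex) set set" where
  "source_open = {p \<in> proj_space UNIV. \<not> vanishes chart_form p}"

text \<open>The preimage of \<open>source_open\<close> under the projection, written as the
  nonvanishing of a single form; the center lies outside because \<open>chart_form\<close> vanishes
  at the zero vector.\<close>

definition target_open :: "(real ^ 'd \<Rightarrow> complex) set set" where
  "target_open = {q \<in> proj_space A. \<not> vanishes (\<lambda>y. chart_form (taut_vec A y)) q}"

text \<open>The chosen representative does not matter, since the \<open>Ph a\<close> are forms of
  one degree.\<close>

definition blend_map :: "('d option \<Rightarrow> complex) set \<Rightarrow> (real ^ 'd \<Rightarrow> complex) set" where
  "blend_map p = proj_point A (\<lambda>a. Ph a (SOME t. t \<in> p))"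

lemma chart_form: "poly_in {1 + n} chart_form"
  unfolding chart_form_def by (rule poly_in_times[OF poly_in_var[of "{1}"] Hh_form]) auto

lemma chart_form_taut: "poly_in {1 * (1 + n)} (\<lambda>y. chart_form (taut_vec A y))"
  by (rule form_compose[OF chart_form form_taut_vec])

lemma taut_vec_P: "taut_vec A (\<lambda>a. P a v) = (\<lambda>j. H v * case_option 1 v j)"
  by (auto simp: fun_eq_iff taut_vec_def P_sum P_moment split: option.split)

lemma Ph_sum: "t None \<noteq> 0 \<Longrightarrow> (\<Sum>a\<in>A. Ph a t) = Hh t"
  by (simp add: Ph_eq Hh_eq P_sum flip: sum_distrib_left)

text \<open>Linear precision in homogeneous coordinates. The division by \<open>t None\<close>
  arises because \<open>(1, v)\<close> is \<open>t\<close> rescaled to have additional coordinate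
  1.\<close>

lemma taut_vec_Ph:
  assumes "t None \<noteq> 0" shows "taut_vec A (\<lambda>a. Ph a t) = (\<lambda>j. Hh t / t None * t j)"
proof -
  let ?v = "\<lambda>k. t (Some k) / t None"
  have "taut_vec A (\<lambda>a. Ph a t) = taut_vec A (\<lambda>a. t None ^ n * P a ?v)"
    by (rule taut_vec_cong) (simp add: Ph_eq assms)
  also have "\<dots> = (\<lambda>j. t None ^ n * (H ?v * case_option 1 ?v j))"
    by (simp only: taut_vec_scale taut_vec_P)
  also have "\<dots> = (\<lambda>j. Hh t / t None * t j)"
    using assms by (auto simp: fun_eq_iff Hh_eq split: option.split)
  finally show ?thesis .
qed

lemma variety_subset: "variety \<subseteq> proj_space A"
  unfolding variety_def zariski_closure_eq[OF param_image_subset] by blast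

lemma variety_closed: "zariski_closed A variety"
  unfolding variety_def by (rule zariski_closed_closure[OF param_image_subset])

text \<open>The coordinates of a point of the variety are recovered from its tautological projection:
  the relation is polynomial, and on the image of the parametrization it is linear precision.\<close>

lemma variety_relation:
  assumes q: "q \<in> variety" "y \<in> q" and a: "a \<in> A"
  shows "y a * Hh (taut_vec A y) = taut_vec A y None * Ph a (taut_vec A y)"
proof -
  define f where "f y = y a * Hh (taut_vec A y) - taut_vec A y None * Ph a (taut_vec A y)" for y
  have f: "poly_in {1 + n} f" unfolding f_def
  proof (rule poly_in_minus)
    show "poly_in {1 + n} (\<lambda>y. y a * Hh (taut_vec A y))"
      by (rule poly_in_times[OF poly_in_var[of "{1}"] form_compose[OF Hh_form form_taut_vec]]) auto
    show "poly_in {1 + n} (\<lambda>y. taut_vec A y None * Ph a (taut_vec A y))"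
      by (rule poly_in_times[OF form_taut_vec form_compose[OF Ph_form[OF a] form_taut_vec]]) auto
  qed
  have "vanishes f (proj_point A (\<lambda>a. P a v))" for v
  proof -
    let ?u = "case_option 1 v :: 'd option \<Rightarrow> complex"
    have t: "taut_vec A (\<lambda>a. if a \<in> A then P a v else 0) = (\<lambda>j. H v * ?u j)"
      using taut_vec_cong[of A "\<lambda>a. if a \<in> A then P a v else 0" "\<lambda>a. P a v"] by (simp add: taut_vec_P)
    \<comment> \<open>Since \<open>?u None = 1\<close>, the homogenizations take the values
      \<open>H v\<close> and \<open>P a v\<close> at \<open>?u\<close>; the rest is scaling. Both
      sides of the relation become \<open>H v ^ (n + 1) * P a v\<close>, also where
      \<open>H v\<close> is zero.\<close>
    have "Hh (\<lambda>j. H v * ?u j) = H v ^ n * H v" "Ph a (\<lambda>j. H v * ?u j) = H v ^ n * P a v"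
      using a by (simp_all add: form_scale[OF Hh_form] form_scale[OF Ph_form[OF a]] Hh_eq Ph_eq)
    then have "f (\<lambda>a. if a \<in> A then P a v else 0) = 0"
      using a by (simp add: f_def t)
    then show ?thesis using vanishes_proj_point[OF f, of A "\<lambda>a. P a v"] by simp
  qed
  then have "\<forall>p\<in>param_image A P. vanishes f p" by (auto simp: param_image_def)
  then have "vanishes f q"
    using q(1) f unfolding variety_def zariski_closure_eq[OF param_image_subset] by blast
  then show ?thesis using q(2) by (auto simp: vanishes_def f_def)
qed

text \<open>By the polynomial relation every coordinate \<open>y a\<close> is the same multiple of
  \<open>Ph a\<close> at the projected vector, and a nonzero \<open>chart_form\<close> makes that
  multiple well defined and nonzero.\<close>

lemma variety_point_eq:
  assumes q: "q \<in> variety" "y \<in> q" and nz: "chart_form (taut_vec A y) \<noteq> 0"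
  shows "q = proj_point A (\<lambda>a. Ph a (taut_vec A y))"
proof -
  have "q = proj_point A y" using proj_space_memD(2)[OF _ q(2)] q(1) variety_subset by blast
  also have "\<dots> = proj_point A (\<lambda>a. Ph a (taut_vec A y))"
  proof (rule proj_point_eqI)
    show "taut_vec A y None / Hh (taut_vec A y) \<noteq> 0" using nz by (simp add: chart_form_def)
    show "y a = taut_vec A y None / Hh (taut_vec A y) * Ph a (taut_vec A y)" if "a \<in> A" for a
      using variety_relation[OF q that] nz by (simp add: chart_form_def field_simps)
  qed
  finally show ?thesis .
qed

section \<open>The blending map and the projection are mutually inverse\<close>

lemma source_open_memD:
  assumes "p \<in> source_open" "t \<in> p" shows "t None \<noteq> 0" "Hh t \<noteq> 0"
proof -
  have "chart_form t \<noteq> 0"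
    using assms vanishes_iff[OF chart_form, of p UNIV t] by (auto simp: source_open_def)
  then show "t None \<noteq> 0" "Hh t \<noteq> 0" by (auto simp: chart_form_def)
qed

lemma source_open_iff: "t \<in> p \<Longrightarrow> p \<in> proj_space UNIV \<Longrightarrow> p \<in> source_open \<longleftrightarrow> chart_form t \<noteq> 0"
  using vanishes_iff[OF chart_form, of p UNIV t] by (auto simp: source_open_def)

lemma target_open_iff: "y \<in> q \<Longrightarrow> q \<in> proj_space A \<Longrightarrow> q \<in> target_open \<longleftrightarrow> chart_form (taut_vec A y) \<noteq> 0"
  using vanishes_iff[OF chart_form_taut, of q A y] by (auto simp: target_open_def)

lemma blend_map_eq:
  assumes p: "p \<in> source_open" and t: "t \<in> p"
  shows "blend_map p = proj_point A (\<lambda>a. Ph a t)"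
proof -
  define s where "s = (SOME t. t \<in> p)"
  have s: "s \<in> p" unfolding s_def by (rule someI[of "\<lambda>t. t \<in> p", OF t])
  have "p \<in> proj_space UNIV" using p by (simp add: source_open_def)
  from proj_space_memD[OF this t] s obtain c where c: "c \<noteq> 0" "s = (\<lambda>j. c * t j)"
    using proj_point_memD by blast
  have "Ph a s = c ^ n * Ph a t" if "a \<in> A" for a
    unfolding c(2) by (rule form_scale[OF Ph_form[OF that]])
  then show ?thesis unfolding blend_map_def s_def[symmetric]
    using c(1) by (intro proj_point_eqI[of "c ^ n"]) auto
qed

lemma Ph_nonzero:
  assumes "p \<in> source_open" "t \<in> p" shows "\<exists>a\<in>A. Ph a t \<noteq> 0"
  using source_open_memD[OF assms] Ph_sum[of t] by (metis sum.neutral)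

lemma blend_map_mem:
  assumes p: "p \<in> source_open"
  shows "blend_map p \<in> variety \<inter> target_open" "taut_proj A (blend_map p) = p"
proof -
  have pP: "p \<in> proj_space UNIV" using p by (simp add: source_open_def)
  obtain t where t: "t \<in> p" "p = proj_point UNIV t" using proj_space_obtain[OF pP] by blast
  note t0 = source_open_memD[OF p t(1)]
  let ?v = "\<lambda>k. t (Some k) / t None" and ?y = "\<lambda>a. if a \<in> A then Ph a t else 0"
  have eq: "blend_map p = proj_point A (\<lambda>a. Ph a t)" by (rule blend_map_eq[OF p t(1)])
  \<comment> \<open>Homogenized and original blending functions differ by the scalar
    \<open>t None ^ n\<close>, so the point lies in the parametrized image itself.\<close>
  also have "\<dots> = proj_point A (\<lambda>a. P a ?v)"
    by (rule proj_point_eqI[of "t None ^ n"]) (use t0 Ph_eq in auto)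
  finally have "blend_map p = proj_point A (\<lambda>a. P a ?v)" .
  moreover have "\<exists>a\<in>A. P a ?v \<noteq> 0" using Ph_nonzero[OF p t(1)] Ph_eq t0 by auto
  ultimately have "blend_map p \<in> param_image A P" unfolding param_image_def by blast
  then have var: "blend_map p \<in> variety"
    unfolding variety_def using zariski_closure_superset by blast
  then have sp: "blend_map p \<in> proj_space A" using variety_subset by blast
  have y: "?y \<in> blend_map p" unfolding eq by (rule proj_point_restrict)
  have tv: "taut_vec A ?y = (\<lambda>j. Hh t / t None * t j)"
    using taut_vec_cong[of A ?y "\<lambda>a. Ph a t"] taut_vec_Ph[of t] t0 by simp
  have "chart_form (taut_vec A ?y) \<noteq> 0"
    using form_scale[OF chart_form, of "Hh t / t None" t] t0 by (simp add: tv chart_form_def)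
  then show "blend_map p \<in> variety \<inter> target_open" using var target_open_iff[OF y sp] by blast
  have "taut_proj A (blend_map p) = proj_point UNIV (\<lambda>j. Hh t / t None * t j)"
    using taut_proj_eq[OF sp y] by (simp only: tv)
  also have "\<dots> = p" unfolding t(2) by (rule proj_point_eqI[of "Hh t / t None"]) (use t0 in auto)
  finally show "taut_proj A (blend_map p) = p" .
qed

lemma taut_proj_mem:
  assumes q: "q \<in> variety \<inter> target_open"
  shows "taut_proj A q \<in> source_open" "blend_map (taut_proj A q) = q"
proof -
  have sp: "q \<in> proj_space A" using q by (simp add: target_open_def)
  obtain y where y: "y \<in> q" using proj_space_obtain[OF sp] by blast
  have nz: "chart_form (taut_vec A y) \<noteq> 0" using target_open_iff[OF y sp] q by blast
  have eq: "taut_proj A q = proj_point UNIV (taut_vec A y)" by (rule taut_proj_eq[OF sp y])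
  have t: "taut_vec A y \<in> taut_proj A q"
    unfolding eq by (rule proj_point_self) (simp add: coord_space_def)
  have "\<exists>j\<in>UNIV. taut_vec A y j \<noteq> 0" using nz by (auto simp: chart_form_def)
  then have "taut_proj A q \<in> proj_space UNIV" unfolding eq proj_space_def by blast
  then show *: "taut_proj A q \<in> source_open" using source_open_iff[OF t] nz by blast
  show "blend_map (taut_proj A q) = q"
    unfolding blend_map_eq[OF * t] using variety_point_eq[OF _ y nz] q by simp
qed

lemma source_open_open: "zariski_open UNIV source_open"
  unfolding source_open_def by (rule zariski_open_nonvanishing[OF chart_form])

lemma target_open_open: "zariski_open A target_open"
  unfolding target_open_def by (rule zariski_open_nonvanishing[OF chart_form_taut])

lemma source_open_nonempty: "source_open \<noteq> {}"
proof -
  obtain v where v: "H v \<noteq> 0" using H_nonzero by blast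
  let ?t = "case_option 1 v :: 'd option \<Rightarrow> complex"
  have "?t \<in> proj_point UNIV ?t" by (rule proj_point_self) (simp add: coord_space_def)
  moreover have "?t None \<noteq> 0" by simp
  then have "proj_point UNIV ?t \<in> proj_space UNIV" unfolding proj_space_def by blast
  moreover have "chart_form ?t \<noteq> 0" using v by (simp add: chart_form_def Hh_eq)
  ultimately show ?thesis using source_open_iff by blast
qed

lemma source_open_affine: "source_open \<subseteq> affine_chart"
proof
  fix p assume p: "p \<in> source_open"
  then have "p \<in> proj_space UNIV" by (simp add: source_open_def)
  moreover from proj_space_obtain[OF this] obtain t where "t \<in> p" by blast
  ultimately show "p \<in> affine_chart"
    unfolding affine_chart_eq vanishes_def using source_open_memD[OF p] by blast
qed

section \<open>Rationality of the variety and its intersection with planes\<close>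

lemma variety_irreducible: "zariski_irreducible A variety"
proof -
  obtain v where "H v \<noteq> 0" using H_nonzero by blast
  then obtain a where "a \<in> A" "P a v \<noteq> 0" using P_sum[of v] by (metis sum.neutral)
  then show ?thesis unfolding variety_def
    by (intro zariski_irreducible_closure param_image_irreducible P_poly)
qed

text \<open>As \<open>source_open\<close> lies in the affine chart, it is an open part of affine
  space, and the two inverse maps, each given globally by forms, identify it with an open part of
  the variety.\<close>

lemma variety_rational: "rational_variety TYPE('d) A variety"
proof -
  have reg1: "regular_map UNIV source_open A (variety \<inter> target_open) blend_map"
  proof (rule regular_map_formsI[where f = Ph and n = n])
    show "(\<exists>a\<in>A. Ph a t \<noteq> 0) \<and> blend_map p = proj_point A (\<lambda>a. Ph a t)"
      if "p \<in> source_open" "t \<in> p" for p t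
      using Ph_nonzero[OF that] blend_map_eq[OF that] by blast
  qed (use blend_map_mem Ph_form in \<open>auto simp: source_open_def\<close>)
  have reg2: "regular_map A (variety \<inter> target_open) UNIV source_open (taut_proj A)"
  proof (rule regular_map_formsI[where f = "\<lambda>j y. taut_vec A y j" and n = 1])
    show "(\<exists>j\<in>UNIV. taut_vec A y j \<noteq> 0) \<and> taut_proj A q = proj_point UNIV (\<lambda>j. taut_vec A y j)"
      if q: "q \<in> variety \<inter> target_open" and y: "y \<in> q" for q y
    proof -
      have sp: "q \<in> proj_space A" using q by (simp add: target_open_def)
      have "chart_form (taut_vec A y) \<noteq> 0" using target_open_iff[OF y sp] q by blast
      then show ?thesis using taut_proj_eq[OF sp y] by (auto simp: chart_form_def)
    qed
  qed (use taut_proj_mem form_taut_vec in \<open>auto simp: target_open_def\<close>)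
  have "biregular UNIV source_open A (variety \<inter> target_open)"
    unfolding biregular_def using reg1 reg2 blend_map_mem(2) taut_proj_mem(2) by blast
  moreover have "affine_chart \<inter> source_open = source_open" using source_open_affine by blast
  moreover have "variety \<inter> target_open \<noteq> {}" using source_open_nonempty blend_map_mem(1) by blast
  ultimately have "birational (UNIV :: 'd option set) affine_chart A variety"
    unfolding birational_def
    using affine_chart_quasi_projective affine_chart_irreducible variety_irreducible
      quasi_projective_closed[OF variety_closed] source_open_open target_open_open source_open_nonempty
    by metis
  then show ?thesis
    unfolding rational_variety_def using variety_closed variety_irreducible by blast
qed

text \<open>The excluded planes are those with parameter outside \<open>source_open\<close>. For the
  others, points off the center have proportional projections by the dimension count, and on the
  variety the projection determines the point.\<close>

lemma planes_meet_variety_once: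
  assumes A: "finite A"
  shows "almost_all_planes_through_center A
      (\<lambda>L. \<exists>\<^sub>\<le>\<^sub>1 p. p \<in> L \<inter> variety \<and> p \<notin> taut_center A)"
  unfolding almost_all_planes_through_center_def
proof (rule exI[of _ source_open], intro conjI allI impI source_open_open source_open_nonempty)
  fix L assume L: "codim_plane A CARD('d) L \<and> taut_center A \<subseteq> L \<and>
    taut_proj A ` (L - taut_center A) \<subseteq> source_open"
  then obtain V where V: "V \<subseteq> coord_space A" "cfun.subspace V" "cfun.dim V + CARD('d) = card A"
    "L = {p \<in> proj_space A. p \<subseteq> V}" unfolding codim_plane_def by blast
  \<comment> \<open>Containment of the center speaks about projective points, so the zero vector,
    which has no class, needs its own case.\<close>
  have E: "y \<in> V" if y: "y \<in> coord_space A" "taut_vec A y = 0" for y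
  proof (cases "y = 0")
    case True
    then show ?thesis using V(2) cfun.subspace_0 by simp
  next
    case False
    then obtain a where "a \<in> A" "y a \<noteq> 0" using y(1) by (auto simp: coord_space_def fun_eq_iff)
    then have sp: "proj_point A y \<in> proj_space A" unfolding proj_space_def by blast
    have "taut_vec A z j = 0" if "z \<in> proj_point A y" for z j
      using proj_point_memD[OF y(1) that] y(2) by (auto simp: taut_vec_scale)
    then have "proj_point A y \<in> L" using L sp by (auto simp: taut_center_def)
    then show ?thesis using proj_point_self[OF y(1)] V(4) by blast
  qed
  have nz: "chart_form (taut_vec A y) \<noteq> 0" if "p \<in> L" "p \<notin> taut_center A" "y \<in> p" for p y
  proof -
    have sp: "p \<in> proj_space A" using that V(4) by blast
    have "taut_proj A p \<in> source_open" using L that by blast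
    moreover have "taut_vec A y \<in> taut_proj A p"
      unfolding taut_proj_eq[OF sp that(3)] by (rule proj_point_self) (simp add: coord_space_def)
    ultimately show ?thesis using source_open_memD by (simp add: chart_form_def)
  qed
  show "\<exists>\<^sub>\<le>\<^sub>1 p. p \<in> L \<inter> variety \<and> p \<notin> taut_center A"
  proof (rule Uniq_I)
    fix p q assume p: "p \<in> L \<inter> variety \<and> p \<notin> taut_center A" and q: "q \<in> L \<inter> variety \<and> q \<notin> taut_center A"
    have "p \<in> proj_space A" "q \<in> proj_space A" using p q V(4) by blast+
    then obtain y z where y: "y \<in> p" and z: "z \<in> q" using proj_space_obtain by metis
    have nz': "chart_form (taut_vec A y) \<noteq> 0" "chart_form (taut_vec A z) \<noteq> 0"
      using nz p q y z by blast+
    then have "taut_vec A z \<noteq> 0" by (auto simp: chart_form_def)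
    moreover have "y \<in> V" "z \<in> V" using p q y z V(4) by blast+
    ultimately obtain c where c: "taut_vec A y = (\<lambda>j. c * taut_vec A z j)"
      using taut_vec_plane_dependent[OF A V(2,1,3) E] by blast
    have "c \<noteq> 0" using nz'(1) by (auto simp: c chart_form_def)
    have "p = proj_point A (\<lambda>a. Ph a (taut_vec A y))"
      using variety_point_eq[OF _ y nz'(1)] p by blast
    also have "\<dots> = proj_point A (\<lambda>a. Ph a (taut_vec A z))"
      by (rule proj_point_eqI[of "c ^ n"]) (use \<open>c \<noteq> 0\<close> form_scale[OF Ph_form] in \<open>auto simp: c\<close>)
    also have "\<dots> = q"
      using variety_point_eq[OF _ z nz'(2)] q by blast
    finally show "p = q" .
  qed
qed

end

theorem theorem2p10:
  fixes A :: "(real ^ 'd::finite) set"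
    and \<beta> :: "real ^ 'd \<Rightarrow> real ^ 'd \<Rightarrow> real"
  assumes "finite A"
    and "aff_dim (convex hull A) = int CARD('d)"
    and "patch A \<beta>"
    and "rational_linear_precision A \<beta>"
  shows "rational_variety TYPE('d) A (patch_variety A \<beta>) \<and>
    almost_all_planes_through_center A
      (\<lambda>L. \<exists>\<^sub>\<le>\<^sub>1 p. p \<in> L \<inter> patch_variety A \<beta> \<and> p \<notin> taut_center A)"
proof -
  have int: "interior (convex hull A) \<noteq> {}" by (rule full_dim_convex_hull_interior[OF assms(2)])
  obtain \<psi> where \<psi>: "self_homeo (convex hull A) \<psi>" "linear_precision A (reparam \<beta> \<psi>)"
    "\<And>a. a \<in> A \<Longrightarrow> rational_on (convex hull A) (normalized A (reparam \<beta> \<psi>) a)"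
    using assms(4) unfolding rational_linear_precision_def by blast
  obtain h :: "('d, real) mpoly" and P where h: "h \<noteq> 0"
    and Ph: "\<And>a x. a \<in> A \<Longrightarrow> x \<in> convex hull A \<Longrightarrow> mpoly_eval h (($) x) \<noteq> 0 \<Longrightarrow>
       normalized A (reparam \<beta> \<psi>) a x = mpoly_eval (P a) (($) x) / mpoly_eval h (($) x)"
    using common_denominator[where f = "normalized A (reparam \<beta> \<psi>)", OF assms(1) \<psi>(3)] by blast
  have "polynomial_blending A \<beta> P" unfolding polynomial_blending_def using \<psi>(1) h Ph by blast
  then have Y: "patch_variety A \<beta> = zariski_closure A (param_image A (complex_blending P))"
    by (rule patch_variety_eq[OF assms(1) int assms(3)])
  define H where "H = mpoly_eval (complexify h)"
  \<comment> \<open>\<open>H\<close> and all \<open>P a\<close> form one family so that a single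
    degree bound, and thus one degree of homogenization, serves them all.\<close>
  define F where "F = case_option H (complex_blending P)"
  have F: "poly_in UNIV (F i)" for i
    by (simp add: F_def H_def complex_blending_def poly_in_eval split: option.split)
  obtain n where n: "\<And>i. i \<in> insert None (Some ` A) \<Longrightarrow> poly_in {..n} (F i)"
    using poly_in_bounded_finite[of "insert None (Some ` A)" F] assms(1) F by auto
  have "\<exists>G. poly_in {n} G \<and> (\<forall>t. t None \<noteq> 0 \<longrightarrow> G t = t None ^ n * F i (\<lambda>k. t (Some k) / t None))"
    if "i \<in> insert None (Some ` A)" for i
    using form_homogenize[OF n[OF that]] by metis
  then obtain G where G: "\<And>i. i \<in> insert None (Some ` A) \<Longrightarrow> poly_in {n} (G i)"
    "\<And>i t. i \<in> insert None (Some ` A) \<Longrightarrow> t None \<noteq> 0 \<Longrightarrow>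
      G i t = t None ^ n * F i (\<lambda>k. t (Some k) / t None)" by metis
  obtain w where "mpoly_eval h w \<noteq> 0" using mpoly_nonzero_real_point[OF h] by auto
  then have H_nz: "H (\<lambda>i. of_real (w i)) \<noteq> 0" by (simp add: H_def mpoly_eval_complexify)
  interpret projective_blending A "complex_blending P" H n "\<lambda>a. G (Some a)" "G None"
  proof
    show "poly_in UNIV (complex_blending P a)" for a by (simp add: complex_blending_def poly_in_eval)
    show "\<exists>v. H v \<noteq> 0" using H_nz by blast
    show "(\<Sum>a\<in>A. complex_blending P a v) = H v"
      "(\<Sum>a\<in>A. complex_blending P a v * of_real (a $ k)) = v k * H v" for v k
      unfolding H_def using linear_precision_identities[OF int \<psi>(2) h Ph] by blast+
    show "G (Some a) t = t None ^ n * complex_blending P a (\<lambda>k. t (Some k) / t None)"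
      if "a \<in> A" "t None \<noteq> 0" for a t
      using G(2)[of "Some a" t] that by (simp add: F_def)
    show "G None t = t None ^ n * H (\<lambda>k. t (Some k) / t None)" if "t None \<noteq> 0" for t
      using G(2)[of None t] that by (simp add: F_def)
  qed (use G(1) in auto)
  have "patch_variety A \<beta> = variety" by (simp add: Y variety_def)
  then show ?thesis using variety_rational planes_meet_variety_once[OF assms(1)] by simp
qed

end
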